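(* Consider the linear control system $\Sigma$ on $G$ with parameters $(a,b),(\alpha,\beta)\in\mathbb{R}^2\setminus\{(0,0)\}$. Then: 1. If $\alpha=0$, then $\Sigma$ has infinitely many control sets. 2. If $\alpha\neq 0$, then $\Sigma$ has exactly one control set. This control set has nonempty interior if and only if $\Sigma$ satisfies the Lie algebra rank condition, i.e. if and only if $\alpha(a\alpha+b\beta)\neq 0$.
   Context: Let $G=\{(x,y)\in\mathbb{R}^2: x>0\}$, which is a Lie group with the product $(x_1,y_1)\cdot(x_2,y_2)=(x_1x_2,\ y_2+x_2y_1)$. Fix $\Omega=[u_*,u^*]$ with $u_*<0<u^*$. The admissible controls $\mathcal U$ are the piecewise constant functions $u:\mathbb{R}\to\Omega$. For constants $(a,b),(\alpha,\beta)\in\mathbb{R}^2\setminus\{(0,0)\}$, the linear control system $\Sigma$ on $G$ is $\dot x=u\alpha x,\quad \dot y=a(x-1)+by+u x\beta,\quad u\in\mathcal U.$ We write $\varphi(t,p,u)$ for the solution with $\varphi(0,p,u)=p$, and $\mathcal O^+(p)=\{\varphi(t,p,u): t\ge 0,\ u\in\mathcal U\}$ for the positive orbit of $p$. A control set is a subset $\mathcal C\subset G$ that is maximal with respect to inclusion among the sets satisfying both of the following: (i) for every $p\in\mathcal C$ there is $u\in\mathcal U$ with $\varphi(t,p,u)\in\mathcal C$ for all $t\ge 0$; (ii) $\mathcal C\subset\operatorname{cl}\mathcal O^+(p)$ for every $p\in\mathcal C$, where the closure is taken in $G$. The Lie algebra rank condition (LARC) holds if the Lie algebra of vector fields generated by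 $f_u(x,y)=(u\alpha x,\ a(x-1)+by+ux\beta)$, $u\in\Omega$, spans $\mathbb{R}^2$ at every point of $G$. *)

theory Defs
  imports "HOL-Analysis.Analysis"
begin

definition Gset :: "(real \<times> real) set" where
  "Gset = {p. fst p > 0}"

definition fld :: "real \<Rightarrow> real \<Rightarrow> real \<Rightarrow> real \<Rightarrow> real \<Rightarrow> real \<times> real \<Rightarrow> real \<times> real" where
  "fld a b \<alpha> \<beta> u p = (u * \<alpha> * fst p, a * (fst p - 1) + b * snd p + u * fst p * \<beta>)"

definition piecewise_const :: "(real \<Rightarrow> real) \<Rightarrow> bool" where
  "piecewise_const u \<longleftrightarrow> (\<forall>s t. \<exists>S. finite S \<and>
      (\<forall>x\<in>{s..t}. \<forall>y\<in>{s..t}. x \<le> y \<longrightarrow> {x..y} \<inter> S = {} \<longrightarrow> u x = u y))"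

definition admissible :: "real \<Rightarrow> real \<Rightarrow> (real \<Rightarrow> real) set" where
  "admissible ulo uhi = {u. piecewise_const u \<and> (\<forall>t. u t \<in> {ulo..uhi})}"

definition is_traj :: "real \<Rightarrow> real \<Rightarrow> real \<Rightarrow> real \<Rightarrow> real \<times> real \<Rightarrow> (real \<Rightarrow> real) \<Rightarrow> (real \<Rightarrow> real \<times> real) \<Rightarrow> bool" where
  "is_traj a b \<alpha> \<beta> p u \<gamma> \<longleftrightarrow> continuous_on {0..} \<gamma> \<and>
     (\<forall>t\<ge>0. ((\<lambda>s. fld a b \<alpha> \<beta> (u s) (\<gamma> s)) has_integral (\<gamma> t - p)) {0..t})"

text \<open>phi(t,p,u) for t \<ge> 0.\<close>
definition phi :: "real \<Rightarrow> real \<Rightarrow> real \<Rightarrow> real \<Rightarrow> real \<Rightarrow> real \<times> real \<Rightarrow> (real \<Rightarrow> real) \<Rightarrow> real \<times> real" where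
  "phi a b \<alpha> \<beta> t p u = (THE q. \<exists>\<gamma>. is_traj a b \<alpha> \<beta> p u \<gamma> \<and> \<gamma> t = q)"

definition pos_orbit :: "real \<Rightarrow> real \<Rightarrow> real \<Rightarrow> real \<Rightarrow> real \<Rightarrow> real \<Rightarrow> real \<times> real \<Rightarrow> (real \<times> real) set" where
  "pos_orbit a b \<alpha> \<beta> ulo uhi p =
     {phi a b \<alpha> \<beta> t p u | t u. t \<ge> 0 \<and> u \<in> admissible ulo uhi}"

definition ctrl_prop :: "real \<Rightarrow> real \<Rightarrow> real \<Rightarrow> real \<Rightarrow> real \<Rightarrow> real \<Rightarrow> (real \<times> real) set \<Rightarrow> bool" where
  "ctrl_prop a b \<alpha> \<beta> ulo uhi C \<longleftrightarrow> C \<subseteq> Gset \<and>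
     (\<forall>p\<in>C. \<exists>u\<in>admissible ulo uhi. \<forall>t\<ge>0. phi a b \<alpha> \<beta> t p u \<in> C) \<and>
     (\<forall>p\<in>C. C \<subseteq> closure (pos_orbit a b \<alpha> \<beta> ulo uhi p) \<inter> Gset)"

definition control_set :: "real \<Rightarrow> real \<Rightarrow> real \<Rightarrow> real \<Rightarrow> real \<Rightarrow> real \<Rightarrow> (real \<times> real) set \<Rightarrow> bool" where
  "control_set a b \<alpha> \<beta> ulo uhi C \<longleftrightarrow> ctrl_prop a b \<alpha> \<beta> ulo uhi C \<and>
     (\<forall>D. ctrl_prop a b \<alpha> \<beta> ulo uhi D \<longrightarrow> C \<subseteq> D \<longrightarrow> D = C)"

definition lie_bracket :: "(real \<times> real \<Rightarrow> real \<times> real) \<Rightarrow> (real \<times> real \<Rightarrow> real \<times> real) \<Rightarrow> real \<times> real \<Rightarrow> real \<times> real" where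
  "lie_bracket X Y p = frechet_derivative Y (at p) (X p) - frechet_derivative X (at p) (Y p)"

inductive_set lie_gen :: "real \<Rightarrow> real \<Rightarrow> real \<Rightarrow> real \<Rightarrow> real \<Rightarrow> real \<Rightarrow> (real \<times> real \<Rightarrow> real \<times> real) set"
  for a b \<alpha> \<beta> ulo uhi where
  gen: "u \<in> {ulo..uhi} \<Longrightarrow> fld a b \<alpha> \<beta> u \<in> lie_gen a b \<alpha> \<beta> ulo uhi"
| add: "X \<in> lie_gen a b \<alpha> \<beta> ulo uhi \<Longrightarrow> Y \<in> lie_gen a b \<alpha> \<beta> ulo uhi \<Longrightarrow> (\<lambda>p. X p + Y p) \<in> lie_gen a b \<alpha> \<beta> ulo uhi"
| scale: "X \<in> lie_gen a b \<alpha> \<beta> ulo uhi \<Longrightarrow> (\<lambda>p. c *\<^sub>R X p) \<in> lie_gen a b \<alpha> \<beta> ulo uhi"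
| bracket: "X \<in> lie_gen a b \<alpha> \<beta> ulo uhi \<Longrightarrow> Y \<in> lie_gen a b \<alpha> \<beta> ulo uhi \<Longrightarrow> lie_bracket X Y \<in> lie_gen a b \<alpha> \<beta> ulo uhi"

definition LARC :: "real \<Rightarrow> real \<Rightarrow> real \<Rightarrow> real \<Rightarrow> real \<Rightarrow> real \<Rightarrow> bool" where
  "LARC a b \<alpha> \<beta> ulo uhi \<longleftrightarrow>
     (\<forall>p\<in>Gset. span {X p | X. X \<in> lie_gen a b \<alpha> \<beta> ulo uhi} = UNIV)"

end

theory Submission
  imports Defs
begin

text \<open>
  For \<open>\<alpha> = 0\<close> every orbit stays on a vertical line, infinitely many vertical lines carry an
  equilibrium of some admissible field, and each equilibrium lies in a control set by Zorn's lemma.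

  For \<open>\<alpha> \<noteq> 0\<close> put \<open>z = y - (\<beta> / \<alpha>) (x - 1)\<close>, \<open>v = \<alpha> u\<close> and \<open>\<kappa> = (a \<alpha> + b \<beta>) / \<alpha>\<close>; the system becomes
  \<open>x' = v x\<close>, \<open>z' = b z + \<kappa> (x - 1)\<close>. If \<open>\<kappa> = 0\<close>, the control set is the curve \<open>z = 0\<close>, since
  \<open>z' = b z\<close>. If \<open>\<kappa> \<noteq> 0\<close>, put \<open>W = 1 - (b / \<kappa>) z\<close>, so that \<open>W' = b (W - x)\<close>. The functionals
  \<open>L_v = b (W - x) - v W\<close> at the two extreme speeds satisfy \<open>L' \<le> b L\<close> or \<open>L' \<ge> b L\<close> along all
  trajectories, which forbids any return to points outside the sector where \<open>b (W - x) / W\<close> lies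
  between the extreme speeds. The sector is closed in the group for \<open>b < 0\<close> and open for \<open>b \<ge> 0\<close>.
  Inside it, approximate controllability passes through equilibria \<open>W = x\<close>: they attract under
  \<open>v = 0\<close> if \<open>b < 0\<close>, and points drift away from their neighbourhoods under \<open>v = 0\<close> if \<open>b \<ge> 0\<close>.
\<close>

section \<open>Trajectories\<close>

lemma nonneg_deriv_off_finite_mono:
  fixes g :: "real \<Rightarrow> real"
  assumes "0 \<le> t" "continuous_on {0..t} g" "finite S"
    and deriv: "\<And>s. s \<in> {0<..<t} - S \<Longrightarrow> \<exists>d\<ge>0. (g has_real_derivative d) (at s)"
  shows "g 0 \<le> g t"
proof -
  \<comment> \<open>Membership in the interval sits under the existential, so the chosen
    \<open>d\<close> is nonnegative at the exceptional times too.\<close>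
  have "\<forall>s. \<exists>d\<ge>0. s \<in> {0<..<t} - S \<longrightarrow> (g has_real_derivative d) (at s)"
    using deriv by blast
  then obtain d where d: "\<And>s. d s \<ge> 0"
      "\<And>s. s \<in> {0<..<t} - S \<Longrightarrow> (g has_real_derivative d s) (at s)"
    by metis
  have "(d has_integral (g t - g 0)) {0..t}"
    using assms(1-3) d(2)
    by (intro fundamental_theorem_of_calculus_interior_strong[of S])
      (auto simp: has_real_derivative_iff_has_vector_derivative)
  then have "0 \<le> g t - g 0"
    by (rule has_integral_nonneg) (rule d(1))
  then show ?thesis
    by simp
qed

text \<open>Continuity gives measurability on the open set left after removing the exceptional
  points, and the finitely many removed points are negligible.\<close>

lemma bounded_continuous_off_finite_integrable:
  fixes f :: "real \<Rightarrow> real"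
  assumes "finite S" "continuous_on ({l<..<r} - S) f" "\<And>s. s \<in> {l..r} \<Longrightarrow> \<bar>f s\<bar> \<le> M"
  shows "f integrable_on {l..r}"
proof -
  let ?A = "{l<..<r} - S"
  have opn: "open ?A"
    using assms(1) by (simp add: finite_imp_closed open_Diff)
  have "f integrable_on ?A"
  proof (rule measurable_bounded_by_integrable_imp_integrable)
    show "f \<in> borel_measurable (lebesgue_on ?A)"
      using assms(2) opn by (intro continuous_imp_measurable_on_sets_lebesgue) auto
    show "(\<lambda>_. M) integrable_on ?A"
    proof (rule integrable_spike_set)
      show "(\<lambda>_. M) integrable_on {l..r}" by (rule integrable_const_ivl)
      show "negligible {x \<in> ?A - {l..r}. M \<noteq> 0}" by (rule negligible_subset[of "{}"]) auto
      show "negligible {x \<in> {l..r} - ?A. M \<noteq> 0}"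
        by (rule negligible_subset[of "insert l (insert r S)"]) (use assms(1) in \<open>auto simp: negligible_finite\<close>)
    qed
    show "?A \<in> sets lebesgue" using opn by auto
    show "norm (f x) \<le> M" if "x \<in> ?A" for x using that assms(3)[of x] by auto
  qed
  then show ?thesis
  proof (rule integrable_spike_set)
    show "negligible {x \<in> ?A - {l..r}. f x \<noteq> 0}" by (rule negligible_subset[of "{}"]) auto
    show "negligible {x \<in> {l..r} - ?A. f x \<noteq> 0}"
      by (rule negligible_subset[of "insert l (insert r S)"]) (use assms(1) in \<open>auto simp: negligible_finite\<close>)
  qed
qed

lemma integral_from_zero_derivative:
  fixes f :: "real \<Rightarrow> 'a::banach"
  assumes "f integrable_on {0..T}" "s \<in> {0<..<T}" "isCont f s"
  shows "((\<lambda>t. integral {0..t} f) has_vector_derivative f s) (at s)"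
proof -
  have "((\<lambda>t. integral {0..t} f) has_vector_derivative f s) (at s within ({0..T} - {}))"
    using assms
    by (intro integral_has_vector_derivative_continuous_at)
      (auto intro: continuous_at_imp_continuous_within)
  then show ?thesis
    using assms(2) at_within_Icc_at[of 0 s T] by simp
qed

text \<open>A finite switching set is closed, so every other time has a ball free of switches. This
  makes the field continuous along a trajectory off the switching times, where the integral equation
  can be differentiated.\<close>

lemma piecewise_const_locally_const:
  assumes "piecewise_const u"
  obtains S where "finite S"
    "\<And>s. s \<in> {0<..<T} - S \<Longrightarrow> \<forall>\<^sub>F r in nhds s. u r = u s"
proof -
  obtain S where S: "finite S"
    "\<And>x y. x \<in> {0..T} \<Longrightarrow> y \<in> {0..T} \<Longrightarrow> x \<le> y \<Longrightarrow> {x..y} \<inter> S = {} \<Longrightarrow> u x = u y"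
    using assms unfolding piecewise_const_def by meson
  have "\<forall>\<^sub>F r in nhds s. u r = u s" if s: "s \<in> {0<..<T} - S" for s
  proof -
    have "open ({0<..<T} - S)"
      using S(1) by (simp add: finite_imp_closed open_Diff)
    then obtain e where e: "e > 0" "ball s e \<subseteq> {0<..<T} - S"
      using s openE by blast
    have "u r = u s" if r: "r \<in> ball s e" for r
    proof -
      have seg: "closed_segment s r \<subseteq> {0<..<T} - S"
        using e r closed_segment_subset[of s "ball s e" r] by auto
      have in_T: "s \<in> {0..T}" "r \<in> {0..T}"
        using s e(2) r by auto
      have "u s = u r" if "s \<le> r"
        using seg that by (intro S(2) in_T) (auto simp: closed_segment_eq_real_ivl1)
      moreover have "u r = u s" if "r \<le> s"
        using seg that by (intro S(2) in_T) (auto simp: closed_segment_commute[of s] closed_segment_eq_real_ivl1)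
      ultimately show ?thesis
        by (metis linear)
    qed
    moreover have "\<forall>\<^sub>F r in nhds s. r \<in> ball s e"
      using e(1) by (intro eventually_nhds_in_open) auto
    ultimately show ?thesis by (auto elim: eventually_mono)
  qed
  with S(1) show ?thesis by (rule that)
qed

lemma piecewise_const_const: "piecewise_const (\<lambda>_. c)"
  unfolding piecewise_const_def by auto

lemma piecewise_const_switch:
  assumes "piecewise_const u"
  shows "piecewise_const (\<lambda>r. if r < s then u r else c)"
  unfolding piecewise_const_def
proof (intro allI)
  fix l r
  obtain S where S: "finite S"
    "\<And>x y. x \<in> {l..r} \<Longrightarrow> y \<in> {l..r} \<Longrightarrow> x \<le> y \<Longrightarrow> {x..y} \<inter> S = {} \<Longrightarrow> u x = u y"
    using assms unfolding piecewise_const_def by meson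
  have "(if x < s then u x else c) = (if y < s then u y else c)"
    if "x \<in> {l..r}" "y \<in> {l..r}" "x \<le> y" "{x..y} \<inter> insert s S = {}" for x y
    using S(2)[of x y] that by auto
  then show "\<exists>S. finite S \<and> (\<forall>x\<in>{l..r}. \<forall>y\<in>{l..r}. x \<le> y \<longrightarrow> {x..y} \<inter> S = {} \<longrightarrow>
      (if x < s then u x else c) = (if y < s then u y else c))"
    using S(1) by (intro exI[of _ "insert s S"]) blast
qed

section \<open>Solutions: differential form, Gronwall estimate, existence by quadrature\<close>

locale linear_control_system =
  fixes a b \<alpha> \<beta> ulo uhi :: real
  assumes ulo_neg: "ulo < 0" and uhi_pos: "0 < uhi"
begin

abbreviation "adm \<equiv> admissible ulo uhi"
abbreviation "flow \<equiv> phi a b \<alpha> \<beta>"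

text \<open>Differential form of \<open>is_traj\<close>, suited to monotonicity arguments by
  derivatives. The exceptional set depends on \<open>T\<close>, since infinitely many switches may
  occur over unbounded time.\<close>

definition solves :: "real \<times> real \<Rightarrow> (real \<Rightarrow> real) \<Rightarrow> (real \<Rightarrow> real \<times> real) \<Rightarrow> bool" where
  "solves p u \<gamma> \<longleftrightarrow> continuous_on {0..} \<gamma> \<and> \<gamma> 0 = p \<and>
     (\<forall>T. \<exists>S. finite S \<and>
        (\<forall>s\<in>{0<..<T} - S. (\<gamma> has_vector_derivative fld a b \<alpha> \<beta> (u s) (\<gamma> s)) (at s)))"

lemma admissible_piecewise_const: "u \<in> adm \<Longrightarrow> piecewise_const u"
  by (simp add: admissible_def)

lemma admissible_const: "c \<in> {ulo..uhi} \<Longrightarrow> (\<lambda>_. c) \<in> adm"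
  by (auto simp: admissible_def piecewise_const_const)

lemma is_traj_imp_solves:
  assumes "piecewise_const u" "is_traj a b \<alpha> \<beta> p u \<gamma>"
  shows "solves p u \<gamma>"
proof -
  let ?F = "\<lambda>s. fld a b \<alpha> \<beta> (u s) (\<gamma> s)"
  have cont: "continuous_on {0..} \<gamma>"
    and int: "\<And>t. t \<ge> 0 \<Longrightarrow> (?F has_integral (\<gamma> t - p)) {0..t}"
    using assms(2) by (auto simp: is_traj_def)
  have "(?F has_integral 0) {0..0}"
    using has_integral_refl(2)[of ?F 0] by simp
  then have "\<gamma> 0 - p = 0"
    by (rule has_integral_unique[OF int[OF order_refl]])
  then have start: "\<gamma> 0 = p"
    by simp
  have "\<exists>S. finite S \<and> (\<forall>s\<in>{0<..<T} - S. (\<gamma> has_vector_derivative ?F s) (at s))" for T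
  proof -
    obtain S where S: "finite S"
      "\<And>s. s \<in> {0<..<T} - S \<Longrightarrow> \<forall>\<^sub>F r in nhds s. u r = u s"
      using piecewise_const_locally_const assms(1) by blast
    have "(\<gamma> has_vector_derivative ?F s) (at s)" if s: "s \<in> {0<..<T} - S" for s
    proof -
      have cs: "isCont \<gamma> s"
        using cont s by (intro continuous_on_interior[OF cont]) (auto simp: interior_Ici[of "-1"])
      have "isCont ?F s \<longleftrightarrow> isCont (\<lambda>r. fld a b \<alpha> \<beta> (u s) (\<gamma> r)) s"
        using S(2)[OF s] by (intro isCont_cong) (auto elim: eventually_mono)
      moreover have "isCont (\<lambda>r. fld a b \<alpha> \<beta> (u s) (\<gamma> r)) s"
        unfolding fld_def by (intro continuous_intros cs)
      ultimately have "((\<lambda>t. integral {0..t} ?F) has_vector_derivative ?F s) (at s)"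
        using int[of T] s by (intro integral_from_zero_derivative[where T=T]) auto
      then have "((\<lambda>t. p + integral {0..t} ?F) has_vector_derivative ?F s) (at s)"
        by (auto intro!: derivative_eq_intros)
      then show ?thesis
      proof (rule has_vector_derivative_transform_within_open)
        show "open {0<..<T}" "s \<in> {0<..<T}" using s by auto
        show "p + integral {0..r} ?F = \<gamma> r" if "r \<in> {0<..<T}" for r
          using int[of r] that by (simp add: integral_unique)
      qed
    qed
    with S(1) show ?thesis by blast
  qed
  with cont start show ?thesis by (simp add: solves_def)
qed

lemma solves_imp_is_traj:
  assumes "solves p u \<gamma>"
  shows "is_traj a b \<alpha> \<beta> p u \<gamma>"
  unfolding is_traj_def
proof (intro conjI allI impI)
  show cont: "continuous_on {0..} \<gamma>" using assms by (simp add: solves_def)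
  fix t :: real assume t: "0 \<le> t"
  obtain S where "finite S"
    "\<forall>s\<in>{0<..<t} - S. (\<gamma> has_vector_derivative fld a b \<alpha> \<beta> (u s) (\<gamma> s)) (at s)"
    using assms unfolding solves_def by blast
  then have "((\<lambda>s. fld a b \<alpha> \<beta> (u s) (\<gamma> s)) has_integral (\<gamma> t - \<gamma> 0)) {0..t}"
    using t by (intro fundamental_theorem_of_calculus_interior_strong[of S])
      (auto intro: continuous_on_subset[OF cont])
  then show "((\<lambda>s. fld a b \<alpha> \<beta> (u s) (\<gamma> s)) has_integral (\<gamma> t - p)) {0..t}"
    using assms by (simp add: solves_def)
qed

text \<open>Serves differential inequalities along a single trajectory: the coordinate equations
  come as premises, and switching times never have to be mentioned.\<close>

lemma solves_mono:
  fixes g :: "real \<Rightarrow> real"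
  assumes "solves p u \<gamma>" "0 \<le> t" "continuous_on {0..t} g"
    and "\<And>s. s \<in> {0<..<t} \<Longrightarrow> ((\<lambda>s. fst (\<gamma> s)) has_real_derivative u s * \<alpha> * fst (\<gamma> s)) (at s) \<Longrightarrow>
      ((\<lambda>s. snd (\<gamma> s)) has_real_derivative
         a * (fst (\<gamma> s) - 1) + b * snd (\<gamma> s) + u s * fst (\<gamma> s) * \<beta>) (at s) \<Longrightarrow>
      \<exists>d\<ge>0. (g has_real_derivative d) (at s)"
  shows "g 0 \<le> g t"
proof -
  obtain S where S: "finite S"
    "\<And>s. s\<in>{0<..<t} - S \<Longrightarrow> (\<gamma> has_vector_derivative fld a b \<alpha> \<beta> (u s) (\<gamma> s)) (at s)"
    using assms(1) unfolding solves_def by blast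
  show ?thesis
  proof (rule nonneg_deriv_off_finite_mono[OF assms(2,3) S(1)])
    fix s assume s: "s \<in> {0<..<t} - S"
    have "((\<lambda>s. fst (\<gamma> s)) has_real_derivative u s * \<alpha> * fst (\<gamma> s)) (at s)"
      using bounded_linear.has_vector_derivative[OF bounded_linear_fst S(2)[OF s]]
      by (simp add: has_real_derivative_iff_has_vector_derivative fld_def)
    moreover have "((\<lambda>s. snd (\<gamma> s)) has_real_derivative
         a * (fst (\<gamma> s) - 1) + b * snd (\<gamma> s) + u s * fst (\<gamma> s) * \<beta>) (at s)"
      using bounded_linear.has_vector_derivative[OF bounded_linear_snd S(2)[OF s]]
      by (simp add: has_real_derivative_iff_has_vector_derivative fld_def)
    ultimately show "\<exists>d\<ge>0. (g has_real_derivative d) (at s)"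
      using assms(4) s by blast
  qed
qed

lemma admissible_bound:
  assumes "u \<in> adm"
  shows "\<bar>u s\<bar> \<le> uhi - ulo"
proof -
  have "u s \<in> {ulo..uhi}" using assms by (simp add: admissible_def)
  then show ?thesis using ulo_neg uhi_pos by auto
qed

text \<open>A constant \<open>K\<close> with
  \<open>(X\<^sup>2 + Y\<^sup>2)' \<le> K (X\<^sup>2 + Y\<^sup>2)\<close> for the difference
  \<open>(X, Y)\<close> of two trajectories under one control.\<close>

definition gronwall_rate :: real where
  "gronwall_rate = 2 * (uhi - ulo) * \<bar>\<alpha>\<bar> + \<bar>a\<bar> + 2 * \<bar>b\<bar> + (uhi - ulo) * \<bar>\<beta>\<bar>"

text \<open>For a fixed control the field is affine in the point, so the difference solves a linear
  equation. The estimate yields both uniqueness and Lipschitz dependence on the initial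
  point.\<close>

lemma solves_gronwall:
  assumes "solves p u \<gamma>" "solves q u \<delta>" "u \<in> adm" "0 \<le> t"
  shows "(norm (\<gamma> t - \<delta> t))\<^sup>2 \<le> exp (gronwall_rate * t) * (norm (p - q))\<^sup>2"
proof -
  obtain S where S: "finite S"
    "\<And>s. s\<in>{0<..<t} - S \<Longrightarrow> (\<gamma> has_vector_derivative fld a b \<alpha> \<beta> (u s) (\<gamma> s)) (at s)"
    using assms(1) unfolding solves_def by blast
  obtain S' where S': "finite S'"
    "\<And>s. s\<in>{0<..<t} - S' \<Longrightarrow> (\<delta> has_vector_derivative fld a b \<alpha> \<beta> (u s) (\<delta> s)) (at s)"
    using assms(2) unfolding solves_def by blast
  define X where "X s = fst (\<gamma> s) - fst (\<delta> s)" for s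
  define Y where "Y s = snd (\<gamma> s) - snd (\<delta> s)" for s
  define g where "g s = - (exp (- gronwall_rate * s) * ((X s)\<^sup>2 + (Y s)\<^sup>2))" for s
  have cont: "continuous_on {0..t} \<gamma>" "continuous_on {0..t} \<delta>"
    using assms(1,2) by (auto simp: solves_def intro: continuous_on_subset)
  have "g 0 \<le> g t"
  proof (rule nonneg_deriv_off_finite_mono)
    show "finite (S \<union> S')" using S(1) S'(1) by simp
    show "continuous_on {0..t} g"
      unfolding g_def X_def Y_def by (intro continuous_intros cont)
    fix s assume s: "s \<in> {0<..<t} - (S \<union> S')"
    let ?X' = "u s * \<alpha> * X s" and ?Y' = "a * X s + b * Y s + u s * X s * \<beta>"
    have \<gamma>': "(\<gamma> has_vector_derivative fld a b \<alpha> \<beta> (u s) (\<gamma> s)) (at s)"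
      using S(2)[of s] s by auto
    have \<delta>': "(\<delta> has_vector_derivative fld a b \<alpha> \<beta> (u s) (\<delta> s)) (at s)"
      using S'(2)[of s] s by auto
    have diff: "((\<lambda>s. \<gamma> s - \<delta> s) has_vector_derivative
        fld a b \<alpha> \<beta> (u s) (\<gamma> s) - fld a b \<alpha> \<beta> (u s) (\<delta> s)) (at s)"
      by (rule has_vector_derivative_diff[OF \<gamma>' \<delta>'])
    have X': "(X has_real_derivative ?X') (at s)"
      using bounded_linear.has_vector_derivative[OF bounded_linear_fst diff]
      by (simp add: has_real_derivative_iff_has_vector_derivative fld_def X_def[abs_def] algebra_simps)
    have Y': "(Y has_real_derivative ?Y') (at s)"
      using bounded_linear.has_vector_derivative[OF bounded_linear_snd diff]
      by (simp add: has_real_derivative_iff_has_vector_derivative fld_def X_def Y_def[abs_def] algebra_simps)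
    have g': "(g has_real_derivative exp (- gronwall_rate * s) *
       (gronwall_rate * ((X s)\<^sup>2 + (Y s)\<^sup>2) - (2 * X s * ?X' + 2 * Y s * ?Y'))) (at s)"
      unfolding g_def by (auto intro!: derivative_eq_intros X' Y' simp: algebra_simps)
    have M: "\<bar>u s\<bar> \<le> uhi - ulo" by (rule admissible_bound[OF assms(3)])
    \<comment> \<open>A quadratic form in \<open>(X, Y)\<close>: the squares are bounded directly,
      the cross term by \<open>2 \<bar>X Y\<bar> \<le> X\<^sup>2 + Y\<^sup>2\<close>.\<close>
    have "2 * X s * ?X' + 2 * Y s * ?Y' =
      2 * (u s * \<alpha>) * (X s)\<^sup>2 + (a + u s * \<beta>) * (2 * X s * Y s) + 2 * b * (Y s)\<^sup>2"
      by (simp add: power2_eq_square algebra_simps)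
    also have "\<dots> \<le> 2 * ((uhi - ulo) * \<bar>\<alpha>\<bar>) * ((X s)\<^sup>2 + (Y s)\<^sup>2)
       + (\<bar>a\<bar> + (uhi - ulo) * \<bar>\<beta>\<bar>) * ((X s)\<^sup>2 + (Y s)\<^sup>2) + 2 * \<bar>b\<bar> * ((X s)\<^sup>2 + (Y s)\<^sup>2)"
    proof (intro add_mono)
      have "u s * \<alpha> \<le> \<bar>u s\<bar> * \<bar>\<alpha>\<bar>"
        by (metis abs_ge_self abs_mult)
      also have "\<dots> \<le> (uhi - ulo) * \<bar>\<alpha>\<bar>"
        by (rule mult_right_mono[OF M abs_ge_zero])
      finally have "2 * (u s * \<alpha>) * (X s)\<^sup>2 \<le> 2 * ((uhi - ulo) * \<bar>\<alpha>\<bar>) * (X s)\<^sup>2"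
        by (intro mult_right_mono mult_left_mono) auto
      also have "\<dots> \<le> 2 * ((uhi - ulo) * \<bar>\<alpha>\<bar>) * ((X s)\<^sup>2 + (Y s)\<^sup>2)"
        using ulo_neg uhi_pos by (intro mult_left_mono) auto
      finally show "2 * (u s * \<alpha>) * (X s)\<^sup>2 \<le> 2 * ((uhi - ulo) * \<bar>\<alpha>\<bar>) * ((X s)\<^sup>2 + (Y s)\<^sup>2)" .
      show "2 * b * (Y s)\<^sup>2 \<le> 2 * \<bar>b\<bar> * ((X s)\<^sup>2 + (Y s)\<^sup>2)"
        by (intro order.trans[OF mult_right_mono mult_left_mono, of "2 * b" "2 * \<bar>b\<bar>"]) auto
      have "\<bar>a + u s * \<beta>\<bar> \<le> \<bar>a\<bar> + (uhi - ulo) * \<bar>\<beta>\<bar>"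
        using mult_right_mono[OF M, of "\<bar>\<beta>\<bar>"] by (auto simp: abs_mult intro: order.trans[OF abs_triangle_ineq])
      moreover have "\<bar>2 * X s * Y s\<bar> \<le> (X s)\<^sup>2 + (Y s)\<^sup>2"
        using sum_squares_bound[of "\<bar>X s\<bar>" "\<bar>Y s\<bar>"] by (simp add: abs_mult)
      ultimately have "\<bar>(a + u s * \<beta>) * (2 * X s * Y s)\<bar> \<le> (\<bar>a\<bar> + (uhi - ulo) * \<bar>\<beta>\<bar>) * ((X s)\<^sup>2 + (Y s)\<^sup>2)"
        unfolding abs_mult[of "a + u s * \<beta>"] by (intro mult_mono) auto
      then show "(a + u s * \<beta>) * (2 * X s * Y s) \<le> (\<bar>a\<bar> + (uhi - ulo) * \<bar>\<beta>\<bar>) * ((X s)\<^sup>2 + (Y s)\<^sup>2)"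
        by linarith
    qed
    also have "\<dots> = gronwall_rate * ((X s)\<^sup>2 + (Y s)\<^sup>2)"
      by (simp add: gronwall_rate_def algebra_simps)
    finally show "\<exists>d\<ge>0. (g has_real_derivative d) (at s)"
      using g' by (intro exI conjI) auto
  qed (use assms in auto)
  moreover have "(norm (\<gamma> t - \<delta> t))\<^sup>2 = (X t)\<^sup>2 + (Y t)\<^sup>2"
    by (simp add: X_def Y_def norm_prod_def)
  moreover have "(norm (p - q))\<^sup>2 = (X 0)\<^sup>2 + (Y 0)\<^sup>2"
    using assms(1,2) by (simp add: X_def Y_def norm_prod_def solves_def)
  ultimately have "exp (- gronwall_rate * t) * (norm (\<gamma> t - \<delta> t))\<^sup>2 \<le> (norm (p - q))\<^sup>2"
    by (simp add: g_def)
  then have "exp (gronwall_rate * t) * (exp (- gronwall_rate * t) * (norm (\<gamma> t - \<delta> t))\<^sup>2)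
      \<le> exp (gronwall_rate * t) * (norm (p - q))\<^sup>2"
    by (intro mult_left_mono) auto
  then show ?thesis
    by (simp add: exp_minus field_simps)
qed

end

lemma primitive_off_finite:
  fixes f :: "real \<Rightarrow> real"
  assumes "\<And>T. \<exists>S M. finite S \<and> (\<forall>s\<in>{0<..<T} - S. isCont f s) \<and> (\<forall>s\<in>{0..T}. \<bar>f s\<bar> \<le> M)"
  shows "continuous_on {0..} (\<lambda>t. integral {0..t} f)"
    and "s > 0 \<Longrightarrow> isCont f s \<Longrightarrow> ((\<lambda>t. integral {0..t} f) has_real_derivative f s) (at s)"
proof -
  have int: "f integrable_on {0..T}" for T
  proof -
    obtain S M where "finite S" "\<forall>s\<in>{0<..<T} - S. isCont f s" "\<forall>s\<in>{0..T}. \<bar>f s\<bar> \<le> M"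
      using assms by meson
    then show ?thesis
      by (intro bounded_continuous_off_finite_integrable[of S _ _ _ M] continuous_at_imp_continuous_on) auto
  qed
  have "isCont (\<lambda>t. integral {0..t} f) s" if "s > 0" for s
    using indefinite_integral_continuous_1[OF int, of "s + 1"] that
    by (intro continuous_on_interior[of "{0..s+1}"]) auto
  moreover have "continuous (at 0 within {0..}) (\<lambda>t. integral {0..t} f)"
  proof -
    have "continuous (at 0 within {0..1}) (\<lambda>t. integral {0..t} f)"
      using indefinite_integral_continuous_1[OF int, of 1] by (simp add: continuous_on_eq_continuous_within)
    moreover have "at (0::real) within {0..1} = at 0 within {0..}"
      by (rule at_within_nhd[of _ "{-1<..<1}"]) auto
    ultimately show ?thesis by simp
  qed
  ultimately show "continuous_on {0..} (\<lambda>t. integral {0..t} f)"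
    unfolding continuous_on_eq_continuous_within
    by (metis atLeast_iff continuous_at_imp_continuous_within less_eq_real_def)
  show "((\<lambda>t. integral {0..t} f) has_real_derivative f s) (at s)" if "s > 0" "isCont f s"
    unfolding has_real_derivative_iff_has_vector_derivative
    using int that by (intro integral_from_zero_derivative[where T="s + 1"]) auto
qed

context linear_control_system
begin

text \<open>The system is triangular: the first equation is solved by an exponential of the
  primitive \<open>U\<close> of the control, the second by variation of constants.\<close>

lemma solves_exists:
  assumes u: "u \<in> adm"
  obtains \<gamma> where "solves p u \<gamma>"
proof -
  have M: "\<bar>u s\<bar> \<le> uhi - ulo" for s by (rule admissible_bound[OF u])
  have loc: "\<exists>S. finite S \<and> (\<forall>s\<in>{0<..<T} - S. isCont u s)" for T
  proof -
    obtain S where "finite S" and S: "\<And>s. s \<in> {0<..<T} - S \<Longrightarrow> \<forall>\<^sub>F r in nhds s. u r = u s"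
      using piecewise_const_locally_const[OF admissible_piecewise_const[OF u]] by blast
    moreover have "isCont u s" if "s \<in> {0<..<T} - S" for s
      using isCont_cong[OF S[OF that]] by simp
    ultimately show ?thesis by blast
  qed
  define U where "U t = integral {0..t} u" for t
  define x where "x t = fst p * exp (\<alpha> * U t)" for t
  \<comment> \<open>The inhomogeneity of the second equation times the integrating factor
    \<open>exp (- b * s)\<close>.\<close>
  define g where "g s = exp (- b * s) * (a * (x s - 1)) + exp (- b * s) * \<beta> * x s * u s" for s
  define y where "y t = exp (b * t) * (snd p + integral {0..t} g)" for t
  have uprim: "\<exists>S M. finite S \<and> (\<forall>s\<in>{0<..<T} - S. isCont u s) \<and> (\<forall>s\<in>{0..T}. \<bar>u s\<bar> \<le> M)" for T
    using loc[of T] M by blast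
  have Ucont: "continuous_on {0..} U"
    unfolding U_def[abs_def] by (rule primitive_off_finite(1)[OF uprim])
  have U': "(U has_real_derivative u s) (at s)" if "s > 0" "isCont u s" for s
    unfolding U_def[abs_def] by (rule primitive_off_finite(2)[OF uprim that])
  have xcont: "continuous_on {0..} x"
    unfolding x_def[abs_def] by (intro continuous_intros Ucont)
  have x': "(x has_real_derivative u s * \<alpha> * x s) (at s)" if "s > 0" "isCont u s" for s
    unfolding x_def[abs_def] by (auto intro!: derivative_eq_intros U' that)
  have gcont: "isCont g s" if "s > 0" "isCont u s" for s
    unfolding g_def[abs_def] using DERIV_isCont[OF x'[OF that]] that by (intro continuous_intros)
  have gprim: "\<exists>S M. finite S \<and> (\<forall>s\<in>{0<..<T} - S. isCont g s) \<and> (\<forall>s\<in>{0..T}. \<bar>g s\<bar> \<le> M)" for T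
  proof -
    obtain S where S: "finite S" "\<forall>s\<in>{0<..<T} - S. isCont u s" using loc by blast
    have xT: "continuous_on {0..T} x" by (rule continuous_on_subset[OF xcont]) auto
    have "bounded ((\<lambda>s. exp (- b * s) * (a * (x s - 1))) ` {0..T})"
      by (intro compact_imp_bounded compact_continuous_image continuous_intros xT) auto
    then obtain M1 where M1: "\<And>s. s \<in> {0..T} \<Longrightarrow> \<bar>exp (- b * s) * (a * (x s - 1))\<bar> \<le> M1"
      unfolding bounded_iff real_norm_def by blast
    have "bounded ((\<lambda>s. exp (- b * s) * \<beta> * x s) ` {0..T})"
      by (intro compact_imp_bounded compact_continuous_image continuous_intros xT) auto
    then obtain M2 where M2: "\<And>s. s \<in> {0..T} \<Longrightarrow> \<bar>exp (- b * s) * \<beta> * x s\<bar> \<le> M2"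
      unfolding bounded_iff real_norm_def by blast
    have "\<bar>g s\<bar> \<le> M1 + M2 * (uhi - ulo)" if "s \<in> {0..T}" for s
    proof -
      have "\<bar>exp (- b * s) * \<beta> * x s * u s\<bar> \<le> M2 * (uhi - ulo)"
        unfolding abs_mult[of "exp (- b * s) * \<beta> * x s"]
        by (rule mult_mono[OF M2[OF that] M]) (use M2[OF that] in auto)
      with M1[OF that] show ?thesis unfolding g_def by linarith
    qed
    with S gcont show ?thesis
      by (intro exI[of _ S] exI[of _ "M1 + M2 * (uhi - ulo)"]) auto
  qed
  have ycont: "continuous_on {0..} y"
    unfolding y_def[abs_def] by (intro continuous_intros primitive_off_finite(1)[OF gprim])
  have y': "(y has_real_derivative a * (x s - 1) + b * y s + u s * x s * \<beta>) (at s)"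
    if "s > 0" "isCont u s" for s
  proof -
    have "(y has_real_derivative b * y s + exp (b * s) * g s) (at s)"
      unfolding y_def[abs_def]
      by (auto intro!: derivative_eq_intros primitive_off_finite(2)[OF gprim] that gcont)
    also have "exp (b * s) * g s = a * (x s - 1) + u s * x s * \<beta>"
      unfolding g_def by (simp add: exp_minus field_simps)
    finally show ?thesis by (simp add: algebra_simps)
  qed
  have "solves p u (\<lambda>t. (x t, y t))"
    unfolding solves_def
  proof (intro conjI allI)
    show "continuous_on {0..} (\<lambda>t. (x t, y t))" by (intro continuous_intros xcont ycont)
    show "(x 0, y 0) = p" by (simp add: x_def y_def U_def)
    fix T
    obtain S where S: "finite S" "\<forall>s\<in>{0<..<T} - S. isCont u s" using loc by blast
    have "((\<lambda>t. (x t, y t)) has_vector_derivative fld a b \<alpha> \<beta> (u s) (x s, y s)) (at s)"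
      if "s \<in> {0<..<T} - S" for s
      using x'[of s] y'[of s] that S(2)
      by (auto simp: fld_def has_real_derivative_iff_has_vector_derivative intro: has_vector_derivative_Pair)
    with S(1) show "\<exists>S. finite S \<and> (\<forall>s\<in>{0<..<T} - S.
        ((\<lambda>t. (x t, y t)) has_vector_derivative fld a b \<alpha> \<beta> (u s) (x s, y s)) (at s))"
      by blast
  qed
  then show ?thesis by (rule that)
qed

lemma solves_unique:
  assumes "solves p u \<gamma>" "solves p u \<delta>" "u \<in> adm" "0 \<le> t"
  shows "\<gamma> t = \<delta> t"
  using solves_gronwall[OF assms] by simp

lemma flow_eq:
  assumes "solves p u \<gamma>" "u \<in> adm" "0 \<le> t"
  shows "flow t p u = \<gamma> t"
  unfolding phi_def
proof (rule the_equality)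
  show "\<exists>\<delta>. is_traj a b \<alpha> \<beta> p u \<delta> \<and> \<delta> t = \<gamma> t"
    using solves_imp_is_traj[OF assms(1)] by blast
  show "q = \<gamma> t" if "\<exists>\<delta>. is_traj a b \<alpha> \<beta> p u \<delta> \<and> \<delta> t = q" for q
    using that is_traj_imp_solves[OF admissible_piecewise_const[OF assms(2)]]
      solves_unique[OF assms(1) _ assms(2,3)] by metis
qed

lemma solves_flow:
  assumes u: "u \<in> adm"
  shows "solves p u (\<lambda>t. flow t p u)"
proof -
  obtain \<gamma> where \<gamma>: "solves p u \<gamma>" using solves_exists[OF u] .
  note eq = flow_eq[OF \<gamma> u]
  show ?thesis
    unfolding solves_def
  proof (intro conjI allI)
    show "continuous_on {0..} (\<lambda>t. flow t p u)"
      by (rule continuous_on_eq[of "{0..}" \<gamma>]) (use \<gamma> eq in \<open>auto simp: solves_def\<close>)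
    show "flow 0 p u = p" using \<gamma> eq[of 0] by (simp add: solves_def)
    fix T
    obtain S where S: "finite S"
      "\<And>s. s\<in>{0<..<T} - S \<Longrightarrow> (\<gamma> has_vector_derivative fld a b \<alpha> \<beta> (u s) (\<gamma> s)) (at s)"
      using \<gamma> unfolding solves_def by blast
    have "((\<lambda>t. flow t p u) has_vector_derivative fld a b \<alpha> \<beta> (u s) (flow s p u)) (at s)"
      if s: "s \<in> {0<..<T} - S" for s
      using has_vector_derivative_transform_within_open[OF S(2)[OF s], of "{0<..<T}" "\<lambda>t. flow t p u"] eq s
      by simp
    with S(1) show "\<exists>S. finite S \<and> (\<forall>s\<in>{0<..<T} - S.
        ((\<lambda>t. flow t p u) has_vector_derivative fld a b \<alpha> \<beta> (u s) (flow s p u)) (at s))"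
      by blast
  qed
qed

lemma flow_0 [simp]: "u \<in> adm \<Longrightarrow> flow 0 p u = p"
  using solves_flow[of u p] by (simp add: solves_def)

lemma continuous_on_flow_time:
  assumes "u \<in> adm" "\<And>t. t \<in> A \<Longrightarrow> 0 \<le> t"
  shows "continuous_on A (\<lambda>t. flow t p u)"
  using solves_flow[OF assms(1), of p] assms(2) unfolding solves_def
  by (auto intro: continuous_on_subset)

lemma continuous_on_flow_initial:
  assumes "u \<in> adm" "0 \<le> t"
  shows "continuous_on A (\<lambda>p. flow t p u)"
proof -
  define L where "L = sqrt (exp (gronwall_rate * t))"
  have "dist (flow t p u) (flow t q u) \<le> L * dist p q" for p q
    using real_sqrt_le_mono[OF solves_gronwall[OF solves_flow solves_flow, OF assms(1,1,1,2), of p q]]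
    by (simp add: L_def dist_norm real_sqrt_mult)
  then have "L-lipschitz_on A (\<lambda>p. flow t p u)"
    by (intro lipschitz_onI) (auto simp: L_def)
  then show ?thesis by (rule lipschitz_on_continuous_on)
qed

lemma flow_mono:
  fixes g :: "real \<Rightarrow> real"
  assumes "u \<in> adm" "0 \<le> t" "continuous_on {0..t} g"
    and "\<And>s. s \<in> {0<..<t} \<Longrightarrow>
      ((\<lambda>s. fst (flow s p u)) has_real_derivative u s * \<alpha> * fst (flow s p u)) (at s) \<Longrightarrow>
      ((\<lambda>s. snd (flow s p u)) has_real_derivative
         a * (fst (flow s p u) - 1) + b * snd (flow s p u) + u s * fst (flow s p u) * \<beta>) (at s) \<Longrightarrow>
      \<exists>d\<ge>0. (g has_real_derivative d) (at s)"
  shows "g 0 \<le> g t"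
  using solves_mono[OF solves_flow[OF assms(1)] assms(2,3,4)] .

text \<open>A lower bound for the square of the first coordinate keeps it away from zero.\<close>

lemma flow_in_Gset:
  assumes p: "p \<in> Gset" and u: "u \<in> adm" and t: "0 \<le> t"
  shows "flow t p u \<in> Gset"
proof -
  let ?x = "\<lambda>s. fst (flow s p u)"
  let ?K = "2 * (uhi - ulo) * \<bar>\<alpha>\<bar>"
  have cx: "continuous_on {0..s} ?x" for s
    by (intro continuous_intros continuous_on_flow_time u) auto
  have nz: "?x s \<noteq> 0" if "0 \<le> s" for s
  proof -
    \<comment> \<open>The rate \<open>?K\<close> dominates
      \<open>2 * \<bar>u r * \<alpha>\<bar>\<close>, so the weighted square cannot decrease,
      whatever the control does.\<close>
    have "exp (?K * 0) * (?x 0)\<^sup>2 \<le> exp (?K * s) * (?x s)\<^sup>2"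
    proof (rule flow_mono[OF u that])
      show "continuous_on {0..s} (\<lambda>s. exp (?K * s) * (?x s)\<^sup>2)"
        by (intro continuous_intros cx)
      fix r assume "(?x has_real_derivative u r * \<alpha> * ?x r) (at r)"
      then have "((\<lambda>s. exp (?K * s) * (?x s)\<^sup>2) has_real_derivative
          exp (?K * r) * (2 * ((uhi - ulo) * \<bar>\<alpha>\<bar> + u r * \<alpha>)) * (?x r)\<^sup>2) (at r)"
        by (auto intro!: derivative_eq_intros simp: algebra_simps power2_eq_square)
      moreover have "\<bar>u r * \<alpha>\<bar> \<le> (uhi - ulo) * \<bar>\<alpha>\<bar>"
        unfolding abs_mult by (rule mult_right_mono[OF admissible_bound[OF u] abs_ge_zero])
      ultimately show "\<exists>d\<ge>0. ((\<lambda>s. exp (?K * s) * (?x s)\<^sup>2) has_real_derivative d) (at r)"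
        by (intro exI conjI) auto
    qed
    moreover have "?x 0 > 0" using p u by (simp add: Gset_def)
    ultimately show ?thesis by auto
  qed
  have "?x t > 0"
  proof (rule ccontr)
    assume "\<not> ?x t > 0"
    moreover have "?x 0 > 0" using p u by (simp add: Gset_def)
    ultimately obtain s where "0 \<le> s" "?x s = 0"
      using IVT2'[of ?x t 0 0] cx t by auto
    then show False using nz by blast
  qed
  then show ?thesis by (simp add: Gset_def)
qed

text \<open>With the exponential rate \<open>b\<close> the second coordinate cancels in the hypothesis on an affine
  functional.\<close>

lemma flow_affine_growth:
  assumes p: "p \<in> Gset" and u: "u \<in> adm" and t: "0 \<le> t"
    and ineq: "\<And>s x. 0 < x \<Longrightarrow> b * (A * x + C) \<le> A * (u s * \<alpha> * x) + B * (a * (x - 1) + u s * x * \<beta>)"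
  shows "exp (b * t) * (A * fst p + B * snd p + C) \<le>
     A * fst (flow t p u) + B * snd (flow t p u) + C"
proof -
  let ?f = "\<lambda>s. A * fst (flow s p u) + B * snd (flow s p u) + C"
  have "exp (- b * 0) * ?f 0 \<le> exp (- b * t) * ?f t"
  proof (rule flow_mono[OF u t])
    show "continuous_on {0..t} (\<lambda>s. exp (- b * s) * ?f s)"
      by (intro continuous_intros continuous_on_flow_time u) auto
    fix s assume s: "s \<in> {0<..<t}" and
      D: "((\<lambda>s. fst (flow s p u)) has_real_derivative u s * \<alpha> * fst (flow s p u)) (at s)"
      "((\<lambda>s. snd (flow s p u)) has_real_derivative
         a * (fst (flow s p u) - 1) + b * snd (flow s p u) + u s * fst (flow s p u) * \<beta>) (at s)"
    let ?x = "fst (flow s p u)"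
    have "((\<lambda>s. exp (- b * s) * ?f s) has_real_derivative
       exp (- b * s) * (A * (u s * \<alpha> * ?x) + B * (a * (?x - 1) + u s * ?x * \<beta>) - b * (A * ?x + C))) (at s)"
      by (auto intro!: derivative_eq_intros D simp: algebra_simps)
    moreover have "0 < ?x"
      using flow_in_Gset[OF p u, of s] s by (simp add: Gset_def)
    ultimately show "\<exists>d\<ge>0. ((\<lambda>s. exp (- b * s) * ?f s) has_real_derivative d) (at s)"
      using ineq[of ?x s] by (intro exI conjI) auto
  qed
  then have "exp (b * t) * ?f 0 \<le> exp (b * t) * (exp (- b * t) * ?f t)"
    by (intro mult_left_mono) auto
  also have "\<dots> = (exp (b * t) * exp (- b * t)) * ?f t"
    by (rule mult.assoc[symmetric])
  also have "exp (b * t) * exp (- b * t) = 1"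
    by (simp add: exp_minus)
  finally show ?thesis
    using u by simp
qed

lemma flow_const_fst:
  assumes c: "c \<in> {ulo..uhi}" and t: "0 \<le> t"
  shows "fst (flow t p (\<lambda>_. c)) = fst p * exp (c * \<alpha> * t)"
proof -
  note u = admissible_const[OF c]
  let ?x = "\<lambda>s. fst (flow s p (\<lambda>_. c))"
  \<comment> \<open>Monotonicity for both \<open>\<sigma> = 1\<close> and
    \<open>\<sigma> = -1\<close> amounts to constancy; the device recurs below.\<close>
  have "\<sigma> * exp (- (c * \<alpha>) * 0) * ?x 0 \<le> \<sigma> * exp (- (c * \<alpha>) * t) * ?x t" for \<sigma>
  proof (rule flow_mono[OF u t])
    show "continuous_on {0..t} (\<lambda>s. \<sigma> * exp (- (c * \<alpha>) * s) * ?x s)"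
      by (intro continuous_intros continuous_on_flow_time u) auto
    fix s assume "(?x has_real_derivative c * \<alpha> * ?x s) (at s)"
    then have "((\<lambda>s. \<sigma> * exp (- (c * \<alpha>) * s) * ?x s) has_real_derivative 0) (at s)"
      by (auto intro!: derivative_eq_intros simp: algebra_simps)
    then show "\<exists>d\<ge>0. ((\<lambda>s. \<sigma> * exp (- (c * \<alpha>) * s) * ?x s) has_real_derivative d) (at s)"
      by blast
  qed
  from this[of 1] this[of "-1"] have "?x 0 = exp (- (c * \<alpha>) * t) * ?x t"
    by simp
  then show ?thesis using u by (simp add: exp_minus field_simps)
qed

text \<open>A constant control needs no time shift when appended, and constant pieces are all that
  the reachability arguments append.\<close>

lemma flow_switch:
  assumes u: "u \<in> adm" and c: "c \<in> {ulo..uhi}" and "0 \<le> s" "0 \<le> t"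
  shows "flow t (flow s p u) (\<lambda>_. c) = flow (s + t) p (\<lambda>r. if r < s then u r else c)"
    and "(\<lambda>r. if r < s then u r else c) \<in> adm"
proof -
  let ?w = "\<lambda>r. if r < s then u r else c" and ?q = "flow s p u"
  show w: "?w \<in> adm"
    using u c piecewise_const_switch[of u s c] by (auto simp: admissible_def)
  note ac = admissible_const[OF c]
  define \<gamma> where "\<gamma> r = (if r \<le> s then flow r p u else flow (r - s) ?q (\<lambda>_. c))" for r
  have "solves p ?w \<gamma>"
    unfolding solves_def
  proof (intro conjI allI)
    have "continuous_on ({0..s} \<union> {s..}) \<gamma>"
      unfolding \<gamma>_def
    proof (rule continuous_on_If)
      have "continuous_on {s..} ((\<lambda>t. flow t ?q (\<lambda>_. c)) \<circ> (\<lambda>r. r - s))"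
        by (rule continuous_on_compose)
          (auto intro!: continuous_intros continuous_on_flow_time ac)
      then show "continuous_on {s..} (\<lambda>r. flow (r - s) ?q (\<lambda>_. c))"
        by (simp add: o_def)
      show "continuous_on {0..s} (\<lambda>r. flow r p u)"
        by (rule continuous_on_flow_time[OF u]) auto
    qed (use ac in auto)
    moreover have "{0..s} \<union> {s..} = {0..}" using assms by auto
    ultimately show "continuous_on {0..} \<gamma>" by simp
    show "\<gamma> 0 = p" using assms by (simp add: \<gamma>_def)
    fix T
    obtain S where S: "finite S"
      "\<And>r. r\<in>{0<..<s} - S \<Longrightarrow> ((\<lambda>t. flow t p u) has_vector_derivative fld a b \<alpha> \<beta> (u r) (flow r p u)) (at r)"
      using solves_flow[OF u, of p] unfolding solves_def by blast
    obtain S' where S': "finite S'"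
      "\<And>r. r\<in>{0<..<T - s} - S' \<Longrightarrow>
         ((\<lambda>t. flow t ?q (\<lambda>_. c)) has_vector_derivative fld a b \<alpha> \<beta> c (flow r ?q (\<lambda>_. c))) (at r)"
      using solves_flow[OF ac, of ?q] unfolding solves_def by blast
    \<comment> \<open>Exceptional times: the switch itself, those of the first piece, and those of
      the second piece moved by \<open>s\<close>.\<close>
    have "(\<gamma> has_vector_derivative fld a b \<alpha> \<beta> (?w r) (\<gamma> r)) (at r)"
      if r: "r \<in> {0<..<T} - insert s (S \<union> (+) s ` S')" for r
    proof (cases "r < s")
      case True
      then show ?thesis
        using has_vector_derivative_transform_within_open[OF S(2)[of r], of "{0<..<s}" \<gamma>] r
        by (simp add: \<gamma>_def)
    next
      case False
      have "r - s \<notin> S'"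
      proof
        assume "r - s \<in> S'"
        then have "s + (r - s) \<in> (+) s ` S'" by (rule imageI)
        with r show False by simp
      qed
      with r False have rs: "r - s \<in> {0<..<T - s} - S'" "s < r" by auto
      have "((\<lambda>t. t - s) has_vector_derivative 1) (at r)"
        by (auto intro!: derivative_eq_intros)
      from vector_diff_chain_at[OF this S'(2)[OF rs(1)]]
      have "((\<lambda>t. flow (t - s) ?q (\<lambda>_. c)) has_vector_derivative fld a b \<alpha> \<beta> c (flow (r - s) ?q (\<lambda>_. c))) (at r)"
        by (simp add: o_def)
      then show ?thesis
        using has_vector_derivative_transform_within_open[of "\<lambda>t. flow (t - s) ?q (\<lambda>_. c)" _ r "{s<..}" \<gamma>] rs(2)
        by (simp add: \<gamma>_def)
    qed
    then show "\<exists>S. finite S \<and> (\<forall>r\<in>{0<..<T} - S. (\<gamma> has_vector_derivative fld a b \<alpha> \<beta> (?w r) (\<gamma> r)) (at r))"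
      using S(1) S'(1) by (intro exI[of _ "insert s (S \<union> (+) s ` S')"]) auto
  qed
  then have "flow (s + t) p ?w = \<gamma> (s + t)"
    using assms by (intro flow_eq w) auto
  also have "\<dots> = flow t ?q (\<lambda>_. c)"
    using assms ac by (cases "t = 0") (auto simp: \<gamma>_def)
  finally show "flow t ?q (\<lambda>_. c) = flow (s + t) p ?w" by simp
qed

section \<open>Closures of positive orbits\<close>

abbreviation "orbit \<equiv> pos_orbit a b \<alpha> \<beta> ulo uhi"

lemma flow_in_orbit: "u \<in> adm \<Longrightarrow> 0 \<le> t \<Longrightarrow> flow t p u \<in> orbit p"
  unfolding pos_orbit_def by blast

lemma self_in_closure_orbit: "p \<in> closure (orbit p)"
proof -
  have "(\<lambda>_. 0) \<in> adm" using ulo_neg uhi_pos by (intro admissible_const) auto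
  then show ?thesis using flow_in_orbit[of "\<lambda>_. 0" 0 p] closure_subset by auto
qed

text \<open>Constant pieces map \<open>orbit p\<close> into itself, and continuity in the initial
  point carries this over to the closure. Reachability can thus be chained through limit points that
  need not be attained.\<close>

lemma flow_const_in_closure_orbit:
  assumes c: "c \<in> {ulo..uhi}" and "0 \<le> t" and q: "q \<in> closure (orbit p)"
  shows "flow t q (\<lambda>_. c) \<in> closure (orbit p)"
proof -
  have "(\<lambda>q. flow t q (\<lambda>_. c)) ` closure (orbit p) \<subseteq> closure (orbit p)"
  proof (rule image_closure_subset)
    show "continuous_on (closure (orbit p)) (\<lambda>q. flow t q (\<lambda>_. c))"
      by (rule continuous_on_flow_initial[OF admissible_const[OF c] assms(2)])
    show "(\<lambda>q. flow t q (\<lambda>_. c)) ` orbit p \<subseteq> closure (orbit p)"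
    proof (rule image_subsetI)
      fix r assume "r \<in> orbit p"
      then obtain s u where su: "r = flow s p u" "0 \<le> s" "u \<in> adm"
        unfolding pos_orbit_def by blast
      have "flow t r (\<lambda>_. c) \<in> orbit p"
        unfolding su(1) flow_switch(1)[OF su(3) c su(2) assms(2)]
        using su assms(2) by (intro flow_in_orbit flow_switch(2)[OF su(3) c su(2) assms(2)]) auto
      then show "flow t r (\<lambda>_. c) \<in> closure (orbit p)"
        using closure_subset by blast
    qed
  qed simp
  then show ?thesis using q by blast
qed

end

section \<open>Obstructions to returning, and the vertical symmetry of the flow\<close>

context linear_control_system
begin

text \<open>Some control keeps \<open>p\<close> in \<open>D\<close>, so \<open>flow 1 p u\<close>
  lies in \<open>D\<close> and its orbit closure contains \<open>p\<close>. A level \<delta> above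
  \<open>f p\<close> that bounds \<open>f\<close> below on that orbit also bounds it on the closure,
  a contradiction.\<close>

lemma ctrl_prop_no_return:
  fixes f :: "real \<times> real \<Rightarrow> real"
  assumes D: "ctrl_prop a b \<alpha> \<beta> ulo uhi D" "p \<in> D" and f: "continuous_on UNIV f"
    and esc: "\<And>u. u \<in> adm \<Longrightarrow> \<exists>\<delta>>f p. \<forall>t\<ge>0. \<forall>v\<in>adm. \<delta> \<le> f (flow t (flow 1 p u) v)"
  shows False
proof -
  obtain u where u: "u \<in> adm" "\<forall>t\<ge>0. flow t p u \<in> D"
    using D unfolding ctrl_prop_def by blast
  then have "p \<in> closure (orbit (flow 1 p u))"
    using D unfolding ctrl_prop_def by (meson IntD1 subsetD zero_le_one)
  moreover obtain \<delta> where \<delta>: "\<delta> > f p" "\<forall>t\<ge>0. \<forall>v\<in>adm. \<delta> \<le> f (flow t (flow 1 p u) v)"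
    using esc[OF u(1)] by blast
  moreover have "orbit (flow 1 p u) \<subseteq> {q. \<delta> \<le> f q}"
    using \<delta>(2) unfolding pos_orbit_def by blast
  moreover have "closed {q. \<delta> \<le> f q}"
    by (intro closed_Collect_le continuous_intros f)
  ultimately have "\<delta> \<le> f p"
    using closure_minimal[of "orbit (flow 1 p u)" "{q. \<delta> \<le> f q}"] by blast
  with \<delta>(1) show False by simp
qed

text \<open>If \<open>b * f p > 0\<close>, then \<open>exp (b * t) * f p\<close> increases with
  \<open>t\<close>, whichever sign \<open>b\<close> and \<open>f p\<close> share; after time 1 the
  value of \<open>f\<close> stays at least \<open>exp b * f p > f p\<close>.\<close>

lemma ctrl_prop_growth_sign:
  fixes f :: "real \<times> real \<Rightarrow> real"
  assumes D: "ctrl_prop a b \<alpha> \<beta> ulo uhi D" "p \<in> D" and f: "continuous_on UNIV f"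
    and grow: "\<And>p u t. p \<in> Gset \<Longrightarrow> u \<in> adm \<Longrightarrow> 0 \<le> t \<Longrightarrow> exp (b * t) * f p \<le> f (flow t p u)"
  shows "b * f p \<le> 0"
proof (rule ccontr)
  assume pos: "\<not> b * f p \<le> 0"
  have p: "p \<in> Gset" using D unfolding ctrl_prop_def by blast
  have expand: "f p < exp (b * t) * f p" if "t > 0" for t
  proof (cases "b > 0")
    case True
    then show ?thesis using pos that by (auto simp: zero_less_mult_iff not_le)
  next
    case False
    then have "b < 0" "f p < 0" using pos by (auto simp: mult_le_0_iff)
    then show ?thesis using that by (simp add: mult_less_cancel_right mult_neg_pos)
  qed
  show False
  proof (rule ctrl_prop_no_return[OF D f])
    fix u assume u: "u \<in> adm"
    have "exp (b * 1) * f p \<le> f (flow t (flow 1 p u) v)" if tv: "0 \<le> t" "v \<in> adm" for t v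
    proof -
      have "exp (b * 1) * f p \<le> exp (b * (t + 1)) * f p"
      proof (cases "b > 0")
        case True
        then show ?thesis using pos tv by (auto simp: zero_less_mult_iff not_le)
      next
        case False
        then have "b < 0" "f p < 0" using pos by (auto simp: mult_le_0_iff)
        then show ?thesis using tv by (simp add: mult_le_cancel_right)
      qed
      also have "\<dots> = exp (b * t) * (exp (b * 1) * f p)"
        by (simp add: exp_add algebra_simps)
      also have "\<dots> \<le> exp (b * t) * f (flow 1 p u)"
        using grow[OF p u, of 1] by simp
      also have "\<dots> \<le> f (flow t (flow 1 p u) v)"
        using tv by (intro grow flow_in_Gset p u) auto
      finally show ?thesis .
    qed
    then show "\<exists>\<delta>>f p. \<forall>t\<ge>0. \<forall>v\<in>adm. \<delta> \<le> f (flow t (flow 1 p u) v)"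
      using expand[of 1] by (intro exI[of _ "exp (b * 1) * f p"]) simp
  qed
qed

lemma control_set_unique:
  assumes "ctrl_prop a b \<alpha> \<beta> ulo uhi C"
    and "\<And>D p. ctrl_prop a b \<alpha> \<beta> ulo uhi D \<Longrightarrow> p \<in> D \<Longrightarrow> p \<in> C"
  shows "control_set a b \<alpha> \<beta> ulo uhi D \<longleftrightarrow> D = C"
  using assms unfolding control_set_def by blast

text \<open>The field depends on the second coordinate only through \<open>b * snd p\<close>, so a
  vertical displacement obeys \<open>d' = b * d\<close> for every control.\<close>

lemma flow_vertical_shift:
  assumes u: "u \<in> adm" and t: "0 \<le> t"
  shows "flow t (p + (0, d)) u = flow t p u + (0, exp (b * t) * d)"
proof (rule flow_eq[OF _ u t])
  show "solves (p + (0, d)) u (\<lambda>t. flow t p u + (0, exp (b * t) * d))"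
    unfolding solves_def
  proof (intro conjI allI)
    show "continuous_on {0..} (\<lambda>t. flow t p u + (0, exp (b * t) * d))"
      by (intro continuous_intros continuous_on_flow_time u) auto
    show "flow 0 p u + (0, exp (b * 0) * d) = p + (0, d)"
      using u by simp
    fix T
    obtain S where S: "finite S"
      "\<And>s. s\<in>{0<..<T} - S \<Longrightarrow> ((\<lambda>t. flow t p u) has_vector_derivative fld a b \<alpha> \<beta> (u s) (flow s p u)) (at s)"
      using solves_flow[OF u, of p] unfolding solves_def by blast
    have "((\<lambda>t. flow t p u + (0, exp (b * t) * d)) has_vector_derivative
        fld a b \<alpha> \<beta> (u s) (flow s p u + (0, exp (b * s) * d))) (at s)"
      if s: "s \<in> {0<..<T} - S" for s
    proof -
      have "((\<lambda>t. exp (b * t) * d) has_vector_derivative b * (exp (b * s) * d)) (at s)"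
        unfolding has_real_derivative_iff_has_vector_derivative[symmetric]
        by (auto intro!: derivative_eq_intros)
      then have "((\<lambda>t. flow t p u + (0, exp (b * t) * d)) has_vector_derivative
         fld a b \<alpha> \<beta> (u s) (flow s p u) + (0, b * (exp (b * s) * d))) (at s)"
        by (intro has_vector_derivative_add S(2)[OF s] has_vector_derivative_Pair has_vector_derivative_const)
      then show ?thesis by (simp add: fld_def algebra_simps)
    qed
    with S(1) show "\<exists>S. finite S \<and> (\<forall>s\<in>{0<..<T} - S.
       ((\<lambda>t. flow t p u + (0, exp (b * t) * d)) has_vector_derivative
        fld a b \<alpha> \<beta> (u s) (flow s p u + (0, exp (b * s) * d))) (at s))"
      by blast
  qed
qed

end

section \<open>The system for a nonzero \<open>\<alpha>\<close>\<close>

text \<open>The coordinate \<open>Z\<close> removes the control from the second equation: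
  with \<open>v = \<alpha> * u\<close> the system reads \<open>x' = v * x\<close>, \<open>Z' = b * Z + \<kappa> * (x - 1)\<close>.\<close>

locale nonvertical_system = linear_control_system +
  assumes alpha_nz: "\<alpha> \<noteq> 0"
begin

definition \<kappa> :: real where "\<kappa> = (a * \<alpha> + b * \<beta>) / \<alpha>"

definition Z :: "real \<times> real \<Rightarrow> real" where
  "Z p = snd p - \<beta> / \<alpha> * (fst p - 1)"

text \<open>Lower bound of the speed \<open>v = \<alpha> * u\<close>; a negative \<alpha> exchanges
  the end points of the control range.\<close>

definition vmin :: real where "vmin = min (\<alpha> * ulo) (\<alpha> * uhi)"
definition vmax :: real where "vmax = max (\<alpha> * ulo) (\<alpha> * uhi)"

lemma vmin_neg: "vmin < 0" and vmax_pos: "0 < vmax"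
proof -
  have "vmin < 0 \<and> 0 < vmax"
  proof (cases "\<alpha> > 0")
    case True
    then show ?thesis using ulo_neg uhi_pos
      by (simp add: vmin_def vmax_def min_less_iff_disj less_max_iff_disj mult_pos_neg)
  next
    case False
    then have "\<alpha> < 0" using alpha_nz by simp
    then show ?thesis using ulo_neg uhi_pos
      by (simp add: vmin_def vmax_def min_less_iff_disj less_max_iff_disj mult_neg_pos mult_neg_neg)
  qed
  then show "vmin < 0" "0 < vmax" by auto
qed

lemma admissible_speed:
  assumes "u \<in> adm"
  shows "vmin \<le> \<alpha> * u s" "\<alpha> * u s \<le> vmax"
proof -
  have "ulo \<le> u s" "u s \<le> uhi" using assms by (auto simp: admissible_def)
  then show "vmin \<le> \<alpha> * u s" "\<alpha> * u s \<le> vmax"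
    using mult_left_mono[of ulo "u s" \<alpha>] mult_left_mono[of "u s" uhi \<alpha>]
      mult_left_mono_neg[of ulo "u s" \<alpha>] mult_left_mono_neg[of "u s" uhi \<alpha>]
    by (cases "\<alpha> \<ge> 0"; force simp: vmin_def vmax_def)+
qed

lemma speed_control:
  assumes "vmin \<le> v" "v \<le> vmax"
  shows "v / \<alpha> \<in> {ulo..uhi}"
proof (cases "\<alpha> > 0")
  case True
  then have "\<alpha> * ulo < \<alpha> * uhi" using ulo_neg uhi_pos by simp
  then show ?thesis using assms True
    by (simp add: vmin_def vmax_def pos_le_divide_eq pos_divide_le_eq mult.commute)
next
  case False
  then have *: "\<alpha> < 0" using alpha_nz by simp
  then have "\<alpha> * uhi < \<alpha> * ulo" using ulo_neg uhi_pos by simp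
  then show ?thesis using assms *
    by (simp add: vmin_def vmax_def neg_le_divide_eq neg_divide_le_eq mult.commute)
qed

abbreviation speed_flow :: "real \<Rightarrow> real \<times> real \<Rightarrow> real \<Rightarrow> real \<times> real" where
  "speed_flow t p v \<equiv> flow t p (\<lambda>_. v / \<alpha>)"

lemma speed_admissible: "vmin \<le> v \<Longrightarrow> v \<le> vmax \<Longrightarrow> (\<lambda>_. v / \<alpha>) \<in> adm"
  by (intro admissible_const speed_control)

lemma speed_flow_fst:
  "vmin \<le> v \<Longrightarrow> v \<le> vmax \<Longrightarrow> 0 \<le> t \<Longrightarrow> fst (speed_flow t p v) = fst p * exp (v * t)"
  using flow_const_fst[OF speed_control] alpha_nz by simp

lemma continuous_on_Z [continuous_intros]:
  "continuous_on A f \<Longrightarrow> continuous_on A (\<lambda>x. Z (f x))"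
  unfolding Z_def by (intro continuous_intros)

lemma Z_growth:
  assumes p: "p \<in> Gset" and u: "u \<in> adm" and t: "0 \<le> t"
    and ineq: "\<And>s x. 0 < x \<Longrightarrow> b * (A * x + C) \<le> A * (\<alpha> * u s) * x + B * (\<kappa> * (x - 1))"
  shows "exp (b * t) * (A * fst p + B * Z p + C) \<le> A * fst (flow t p u) + B * Z (flow t p u) + C"
proof -
  let ?A = "A - B * (\<beta> / \<alpha>)" and ?C = "C + B * (\<beta> / \<alpha>)"
  have "exp (b * t) * (?A * fst p + B * snd p + ?C) \<le>
     ?A * fst (flow t p u) + B * snd (flow t p u) + ?C"
  proof (rule flow_affine_growth[OF p u t])
    fix s x :: real assume "0 < x"
    then have "b * (A * x + C) \<le> A * (\<alpha> * u s) * x + B * (\<kappa> * (x - 1))"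
      by (rule ineq)
    moreover have "A * (\<alpha> * u s) * x + B * (\<kappa> * (x - 1)) - b * (A * x + C) =
        ?A * (u s * \<alpha> * x) + B * (a * (x - 1) + u s * x * \<beta>) - b * (?A * x + ?C)"
      using alpha_nz by (simp add: \<kappa>_def field_simps)
    ultimately show "b * (?A * x + ?C) \<le> ?A * (u s * \<alpha> * x) + B * (a * (x - 1) + u s * x * \<beta>)"
      by linarith
  qed
  then show ?thesis by (simp add: Z_def algebra_simps)
qed

text \<open>For a suitable constant speed the growth inequality applies to a functional and to its
  negative, hence is an equality.\<close>

lemma Z_growth_speed:
  assumes p: "p \<in> Gset" and v: "vmin \<le> v" "v \<le> vmax" and t: "0 \<le> t"
    and eq: "\<And>x. b * (A * x + C) = A * v * x + B * (\<kappa> * (x - 1))"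
  shows "A * fst (speed_flow t p v) + B * Z (speed_flow t p v) + C = exp (b * t) * (A * fst p + B * Z p + C)"
proof (rule antisym)
  note u = speed_admissible[OF v]
  have v': "\<alpha> * (v / \<alpha>) = v" using alpha_nz by simp
  show "exp (b * t) * (A * fst p + B * Z p + C) \<le> A * fst (speed_flow t p v) + B * Z (speed_flow t p v) + C"
    by (rule Z_growth[OF p u t]) (simp only: v' eq)
  have "exp (b * t) * (- A * fst p + - B * Z p + - C) \<le>
      - A * fst (speed_flow t p v) + - B * Z (speed_flow t p v) + - C"
  proof (rule Z_growth[OF p u t])
    fix x show "b * (- A * x + - C) \<le> - A * (\<alpha> * (v / \<alpha>)) * x + - B * (\<kappa> * (x - 1))"
      using eq[of x] by (simp only: v') (simp add: algebra_simps)
  qed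
  then show "A * fst (speed_flow t p v) + B * Z (speed_flow t p v) + C \<le> exp (b * t) * (A * fst p + B * Z p + C)"
    by (simp add: algebra_simps)
qed

lemma Gset_leg:
  assumes "0 < x" "0 < s"
  obtains v t where "vmin \<le> v" "v \<le> vmax" "0 \<le> t" "x * exp (v * t) = s"
proof (cases "x \<le> s")
  case True
  then show ?thesis
    using that[of vmax "ln (s / x) / vmax"] assms vmin_neg vmax_pos by simp
next
  case False
  then show ?thesis
    using that[of vmin "ln (s / x) / vmin"] assms vmin_neg vmax_pos
    by (simp add: divide_nonpos_nonpos ln_le_zero_iff)
qed

lemma reach_abscissa:
  assumes "p \<in> Gset" "0 < s"
  obtains q where "q \<in> closure (orbit p)" "fst q = s"
proof -
  obtain v t where v: "vmin \<le> v" "v \<le> vmax" and t: "0 \<le> t" "fst p * exp (v * t) = s"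
    using Gset_leg[of "fst p" s] assms by (auto simp: Gset_def)
  then show ?thesis
    using that[OF flow_const_in_closure_orbit[OF speed_control[OF v] t(1) self_in_closure_orbit]]
      speed_flow_fst[OF v t(1)] by simp
qed

text \<open>A constant-speed piece carries a vertical line onto a vertical line, since vertical
  displacements are only rescaled.\<close>

lemma reach_from_abscissa:
  assumes line: "\<And>r. fst r = s \<Longrightarrow> r \<in> closure (orbit p)" and "0 < s" "q \<in> Gset"
  shows "q \<in> closure (orbit p)"
proof -
  obtain v t where v: "vmin \<le> v" "v \<le> vmax" and t: "0 \<le> t" "s * exp (v * t) = fst q"
    using Gset_leg[of s "fst q"] assms(2,3) by (auto simp: Gset_def)
  \<comment> \<open>The height missing at the end, pulled back through the factor
    \<open>exp (b * t)\<close>.\<close>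
  define d where "d = (snd q - snd (speed_flow t (s, 0) v)) * exp (- b * t)"
  have "speed_flow t ((s, 0) + (0, d)) v = speed_flow t (s, 0) v + (0, exp (b * t) * d)"
    by (rule flow_vertical_shift[OF speed_admissible[OF v] t(1)])
  also have "\<dots> = q"
    using speed_flow_fst[OF v t(1), of "(s, 0)"] t(2)
    by (simp add: d_def prod_eq_iff exp_minus field_simps)
  finally have "speed_flow t (s, d) v = q" by simp
  then show ?thesis
    using flow_const_in_closure_orbit[OF speed_control[OF v] t(1) line[of "(s, d)"]] by simp
qed

text \<open>Here \<open>Z' = b * Z\<close>. The curve \<open>Z = 0\<close> is invariant and any two
  of its points are joined by moving the abscissa; the growth argument for both \<open>Z\<close> and
  \<open>- Z\<close> gives \<open>b * Z = 0\<close> on every candidate set.\<close>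

lemma control_set_kappa_zero:
  assumes "\<kappa> = 0" "b \<noteq> 0"
  shows "control_set a b \<alpha> \<beta> ulo uhi C \<longleftrightarrow> C = {p \<in> Gset. Z p = 0}"
proof (rule control_set_unique)
  have Z_flow: "Z (flow t p u) = 0" if "p \<in> Gset" "Z p = 0" "u \<in> adm" "0 \<le> t" for p u t
    using Z_growth[OF that(1,3,4), of 0 0 1] Z_growth[OF that(1,3,4), of 0 0 "-1"] assms that
    by simp
  show "ctrl_prop a b \<alpha> \<beta> ulo uhi {p \<in> Gset. Z p = 0}"
    unfolding ctrl_prop_def
  proof (intro conjI ballI subsetI)
    fix p assume p: "p \<in> {p \<in> Gset. Z p = 0}"
    have "(\<lambda>_. 0) \<in> adm" using ulo_neg uhi_pos by (intro admissible_const) auto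
    then show "\<exists>u\<in>adm. \<forall>t\<ge>0. flow t p u \<in> {p \<in> Gset. Z p = 0}"
      using p Z_flow flow_in_Gset by blast
    fix q assume q: "q \<in> {p \<in> Gset. Z p = 0}"
    obtain v t where v: "vmin \<le> v" "v \<le> vmax" and t: "0 \<le> t" "fst p * exp (v * t) = fst q"
      using Gset_leg[of "fst p" "fst q"] p q by (auto simp: Gset_def)
    have "fst (speed_flow t p v) = fst q" "Z (speed_flow t p v) = Z q"
      using speed_flow_fst[OF v t(1)] t(2) Z_flow[of p] p q speed_admissible[OF v] t(1) by auto
    then have "speed_flow t p v = q"
      by (simp add: Z_def prod_eq_iff)
    then show "q \<in> closure (orbit p) \<inter> Gset"
      using flow_const_in_closure_orbit[OF speed_control[OF v] t(1) self_in_closure_orbit, of p] q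
      by simp
  qed simp
next
  fix D p assume D: "ctrl_prop a b \<alpha> \<beta> ulo uhi D" "p \<in> D"
  have "b * (\<sigma> * Z p) \<le> 0" for \<sigma>
  proof (rule ctrl_prop_growth_sign[OF D])
    show "continuous_on UNIV (\<lambda>p. \<sigma> * Z p)" by (intro continuous_intros)
    show "exp (b * t) * (\<sigma> * Z p) \<le> \<sigma> * Z (flow t p u)" if "p \<in> Gset" "u \<in> adm" "0 \<le> t" for p u t
      using Z_growth[OF that, of 0 0 \<sigma>] assms by simp
  qed
  from this[of 1] this[of "-1"] have "Z p = 0" using assms(2) by simp
  then show "p \<in> {p \<in> Gset. Z p = 0}" using D by (auto simp: ctrl_prop_def)
qed

end

section \<open>The sector of controllability\<close>

locale rank_system = nonvertical_system +
  assumes kappa_nz: "\<kappa> \<noteq> 0"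
begin

text \<open>If \<open>b \<noteq> 0\<close>, the pair \<open>(x, W)\<close> satisfies \<open>x' = v * x\<close>, \<open>W' = b * (W - x)\<close>, which is homogeneous:
  the ratio \<open>W / x\<close> evolves by itself, and the control set is a sector. If \<open>b = 0\<close>, then
  \<open>W = 1\<close> and the sector degenerates to the whole group.\<close>

definition W :: "real \<times> real \<Rightarrow> real" where
  "W p = 1 - b / \<kappa> * Z p"

text \<open>The speed \<open>b * (W - x) / W\<close> that fixes the ratio \<open>W / x\<close> must
  be available. The condition is multiplied by \<open>W\<close>, whose positivity is a
  consequence.\<close>

definition sector :: "(real \<times> real) set" where
  "sector = {p \<in> Gset.
     if b < 0 then vmin * W p \<le> b * (W p - fst p) \<and> b * (W p - fst p) \<le> vmax * W p
     else vmin * W p < b * (W p - fst p) \<and> b * (W p - fst p) < vmax * W p}"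

text \<open>Rest points of the zero control: the expression is \<open>Z'\<close>.\<close>

definition equilibria :: "(real \<times> real) set" where
  "equilibria = {p \<in> Gset. b * Z p + \<kappa> * (fst p - 1) = 0}"

lemma equilibria_iff_W: "b \<noteq> 0 \<Longrightarrow> p \<in> equilibria \<longleftrightarrow> p \<in> Gset \<and> W p = fst p"
  using kappa_nz by (auto simp: equilibria_def W_def field_simps)

lemma continuous_on_W [continuous_intros]:
  "continuous_on A f \<Longrightarrow> continuous_on A (\<lambda>x. W (f x))"
  unfolding W_def by (intro continuous_intros)

lemma sector_eq_Gset: "b = 0 \<Longrightarrow> sector = Gset"
  unfolding sector_def W_def using vmin_neg vmax_pos by simp

text \<open>In \<open>(x, W)\<close> the equations are homogeneous, so \<open>x > 0\<close> divides
  out and the hypothesis concerns coefficients and speed alone.\<close>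

lemma W_growth:
  assumes p: "p \<in> Gset" and u: "u \<in> adm" and t: "0 \<le> t"
    and ineq: "\<And>v. vmin \<le> v \<Longrightarrow> v \<le> vmax \<Longrightarrow> b * (A + B) \<le> A * v"
  shows "exp (b * t) * (A * fst p + B * W p) \<le> A * fst (flow t p u) + B * W (flow t p u)"
proof -
  have "exp (b * t) * (A * fst p + (- B * b / \<kappa>) * Z p + B) \<le>
     A * fst (flow t p u) + (- B * b / \<kappa>) * Z (flow t p u) + B"
  proof (rule Z_growth[OF p u t])
    fix s x :: real assume "0 < x"
    then have "b * (A + B) * x \<le> A * (\<alpha> * u s) * x"
      using ineq[OF admissible_speed[OF u]] by (intro mult_right_mono) auto
    moreover have "(- B * b / \<kappa>) * (\<kappa> * (x - 1)) = - B * b * (x - 1)"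
      using kappa_nz by simp
    ultimately show "b * (A * x + B) \<le> A * (\<alpha> * u s) * x + (- B * b / \<kappa>) * (\<kappa> * (x - 1))"
      by (simp add: algebra_simps)
  qed
  then show ?thesis by (simp add: W_def algebra_simps)
qed

lemma W_growth_speed:
  assumes p: "p \<in> Gset" and v: "vmin \<le> v" "v \<le> vmax" and t: "0 \<le> t"
    and eq: "b * (A + B) = A * v"
  shows "A * fst (speed_flow t p v) + B * W (speed_flow t p v) = exp (b * t) * (A * fst p + B * W p)"
proof -
  have "A * fst (speed_flow t p v) + (- B * b / \<kappa>) * Z (speed_flow t p v) + B =
     exp (b * t) * (A * fst p + (- B * b / \<kappa>) * Z p + B)"
  proof (rule Z_growth_speed[OF p v t])
    fix x
    have "b * (A + B) * x = A * v * x" by (simp only: eq)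
    moreover have "(- B * b / \<kappa>) * (\<kappa> * (x - 1)) = - B * b * (x - 1)"
      using kappa_nz by simp
    ultimately show "b * (A * x + B) = A * v * x + (- B * b / \<kappa>) * (\<kappa> * (x - 1))"
      by (simp add: algebra_simps)
  qed
  then show ?thesis by (simp add: W_def algebra_simps)
qed

section \<open>Exclusion of points outside the sector\<close>

lemma W_strict_mono:
  assumes u: "u \<in> adm" and t: "0 < t"
    and pos: "\<And>s. s \<in> {0..t} \<Longrightarrow> \<sigma> * b * (W (flow s p u) - fst (flow s p u)) > 0"
  shows "\<sigma> * W p < \<sigma> * W (flow t p u)"
proof -
  let ?h = "\<lambda>s. \<sigma> * b * (W (flow s p u) - fst (flow s p u))"
  have c: "continuous_on {0..t} (\<lambda>s. flow s p u)"
    by (intro continuous_on_flow_time u) auto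
  have "continuous_on {0..t} ?h"
    by (intro continuous_intros c)
  \<comment> \<open>The rate \<open>?h\<close> of \<open>\<sigma> * W\<close> has a positive minimum
    by compactness; subtracting this slope turns weak monotonicity into strict monotonicity.\<close>
  then obtain s0 where s0: "s0 \<in> {0..t}" "\<And>s. s \<in> {0..t} \<Longrightarrow> ?h s0 \<le> ?h s"
    using continuous_attains_inf[of "{0..t}" ?h] t by auto
  let ?g = "\<lambda>s. \<sigma> * W (flow s p u) - ?h s0 * s"
  have "?g 0 \<le> ?g t"
  proof (rule flow_mono[OF u])
    show "continuous_on {0..t} ?g"
      by (intro continuous_intros c)
    fix s assume s: "s \<in> {0<..<t}" and
      D: "((\<lambda>s. fst (flow s p u)) has_real_derivative u s * \<alpha> * fst (flow s p u)) (at s)"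
      "((\<lambda>s. snd (flow s p u)) has_real_derivative
         a * (fst (flow s p u) - 1) + b * snd (flow s p u) + u s * fst (flow s p u) * \<beta>) (at s)"
    have "(?g has_real_derivative ?h s - ?h s0) (at s)"
      unfolding W_def Z_def using alpha_nz kappa_nz
      by (auto intro!: derivative_eq_intros D simp: field_simps) (simp add: \<kappa>_def field_simps)
    then show "\<exists>d\<ge>0. (?g has_real_derivative d) (at s)"
      using s0(2)[of s] s by (intro exI[of _ "?h s - ?h s0"]) auto
  qed (use t in auto)
  moreover have "?h s0 * t > 0" using pos[OF s0(1)] t by simp
  ultimately show ?thesis using u by simp
qed

text \<open>Along trajectories in the invariant set \<open>E\<close> the function
  \<open>\<sigma> * W\<close> strictly increases, so its value after time 1 is never undercut
  again.\<close>

lemma ctrl_prop_no_drift: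
  assumes D: "ctrl_prop a b \<alpha> \<beta> ulo uhi D" "p \<in> D" and "p \<in> E"
    and inv: "\<And>p u t. p \<in> E \<Longrightarrow> u \<in> adm \<Longrightarrow> 0 \<le> t \<Longrightarrow> flow t p u \<in> E"
    and pos: "\<And>p. p \<in> E \<Longrightarrow> \<sigma> * b * (W p - fst p) > 0"
  shows False
proof (rule ctrl_prop_no_return[OF D, of "\<lambda>p. \<sigma> * W p"])
  show "continuous_on UNIV (\<lambda>p. \<sigma> * W p)" by (intro continuous_intros)
  fix u assume u: "u \<in> adm"
  have step: "\<sigma> * W q < \<sigma> * W (flow t q v)" if "q \<in> E" "v \<in> adm" "0 < t" for q v t
    using that by (intro W_strict_mono pos inv) auto
  let ?q = "flow 1 p u"
  have "\<sigma> * W ?q \<le> \<sigma> * W (flow t ?q v)" if "0 \<le> t" "v \<in> adm" for t v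
    using step[of ?q v t] inv[OF \<open>p \<in> E\<close> u, of 1] that by (cases "t = 0") auto
  then show "\<exists>\<delta>>\<sigma> * W p. \<forall>t\<ge>0. \<forall>v\<in>adm. \<delta> \<le> \<sigma> * W (flow t ?q v)"
    using step[OF \<open>p \<in> E\<close> u, of 1] by (intro exI[of _ "\<sigma> * W ?q"]) auto
qed

text \<open>Within the group the closed sector is where \<open>?Lmin\<close> and
  \<open>?Lmax\<close> are nonnegative. For \<open>b \<noteq> 0\<close> the growth argument gives
  these signs; for \<open>b > 0\<close> the boundary remains and is removed by the drift
  argument.\<close>

lemma ctrl_prop_in_sector:
  assumes D: "ctrl_prop a b \<alpha> \<beta> ulo uhi D" "p \<in> D"
  shows "p \<in> sector"
proof -
  have p: "p \<in> Gset" using D by (auto simp: ctrl_prop_def)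
  let ?Lmin = "\<lambda>p. b * (W p - fst p) - vmin * W p"
  let ?Lmax = "\<lambda>p. vmax * W p - b * (W p - fst p)"
  consider "b < 0" | "b = 0" | "b > 0" by linarith
  then show ?thesis
  proof cases
    case 1
    have "b * ?Lmin p \<le> 0"
    proof (rule ctrl_prop_growth_sign[OF D])
      show "continuous_on UNIV ?Lmin" by (intro continuous_intros)
      show "exp (b * t) * ?Lmin p \<le> ?Lmin (flow t p u)" if "p \<in> Gset" "u \<in> adm" "0 \<le> t" for p u t
        using W_growth[OF that, of "-b" "b - vmin"] 1 by (simp add: algebra_simps)
    qed
    moreover have "b * ?Lmax p \<le> 0"
    proof (rule ctrl_prop_growth_sign[OF D])
      show "continuous_on UNIV ?Lmax" by (intro continuous_intros)
      show "exp (b * t) * ?Lmax p \<le> ?Lmax (flow t p u)" if "p \<in> Gset" "u \<in> adm" "0 \<le> t" for p u t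
        using W_growth[OF that, of b "vmax - b"] 1 by (simp add: algebra_simps)
    qed
    ultimately have "?Lmin p \<ge> 0" "?Lmax p \<ge> 0"
      using 1 by (auto simp: mult_le_0_iff)
    then show ?thesis using 1 p by (simp add: sector_def)
  next
    case 2
    then show ?thesis using p sector_eq_Gset by blast
  next
    case 3
    have grow_min: "exp (b * t) * (- ?Lmin p) \<le> - ?Lmin (flow t p u)" if "p \<in> Gset" "u \<in> adm" "0 \<le> t" for p u t
      using W_growth[OF that, of b "vmin - b"] 3 by (simp add: algebra_simps)
    have grow_max: "exp (b * t) * (- ?Lmax p) \<le> - ?Lmax (flow t p u)" if "p \<in> Gset" "u \<in> adm" "0 \<le> t" for p u t
      using W_growth[OF that, of "-b" "b - vmax"] 3 by (simp add: algebra_simps)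
    have "b * (- ?Lmin p) \<le> 0"
    proof (rule ctrl_prop_growth_sign[OF D])
      show "continuous_on UNIV (\<lambda>p. - ?Lmin p)" by (intro continuous_intros)
    qed (rule grow_min)
    then have Lmin: "?Lmin p \<ge> 0" using 3 by (auto simp: mult_le_0_iff)
    have "b * (- ?Lmax p) \<le> 0"
    proof (rule ctrl_prop_growth_sign[OF D])
      show "continuous_on UNIV (\<lambda>p. - ?Lmax p)" by (intro continuous_intros)
    qed (rule grow_max)
    then have Lmax: "?Lmax p \<ge> 0" using 3 by (auto simp: mult_le_0_iff)
    \<comment> \<open>On the invariant set \<open>?Lmin \<le> 0\<close> the value \<open>W\<close>
      strictly decreases: \<open>b * (W - x) \<le> vmin * W < 0\<close> if \<open>W > 0\<close>, and
      otherwise \<open>W < x\<close>.\<close>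
    have "?Lmin p \<noteq> 0"
    proof
      assume Lmin0: "?Lmin p = 0"
      show False
      proof (rule ctrl_prop_no_drift[OF D, of "{q \<in> Gset. ?Lmin q \<le> 0}" "-1"])
        show "p \<in> {q \<in> Gset. ?Lmin q \<le> 0}" using p Lmin0 by simp
        show "flow t q u \<in> {q \<in> Gset. ?Lmin q \<le> 0}"
          if "q \<in> {q \<in> Gset. ?Lmin q \<le> 0}" "u \<in> adm" "0 \<le> t" for q u t
        proof -
          have "0 \<le> exp (b * t) * (- ?Lmin q)" using that by (intro mult_nonneg_nonneg) auto
          also have "\<dots> \<le> - ?Lmin (flow t q u)" using that by (intro grow_min) auto
          finally show ?thesis using that flow_in_Gset[of q u t] by auto
        qed
        show "-1 * b * (W q - fst q) > 0" if q: "q \<in> {q \<in> Gset. ?Lmin q \<le> 0}" for q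
        proof (cases "W q > 0")
          case True
          then have "vmin * W q < 0" using vmin_neg by (simp add: mult_neg_pos)
          then show ?thesis using q by auto
        next
          case False
          then have "W q - fst q < 0" using q by (auto simp: Gset_def)
          then show ?thesis using 3 by (simp add: mult_pos_neg)
        qed
      qed
    qed
    \<comment> \<open>Here \<open>W\<close> strictly increases. A boundary point with
      \<open>W > 0\<close> forces \<open>b > vmax\<close>, which makes \<open>W\<close> positive on
      all of \<open>?Lmax \<le> 0\<close>, so that
      \<open>b * (W - x) \<ge> vmax * W > 0\<close>.\<close>
    moreover have "?Lmax p \<noteq> 0"
    proof
      assume Lmax0: "?Lmax p = 0"
      have fp: "fst p > 0" using p by (simp add: Gset_def)
      have "(b - vmin) * W p \<ge> b * fst p" using Lmin by (simp add: algebra_simps)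
      moreover have "b * fst p > 0" using 3 fp by simp
      ultimately have "(b - vmin) * W p > 0" by linarith
      then have Wp: "W p > 0" using 3 vmin_neg by (simp add: zero_less_mult_iff)
      have "(b - vmax) * W p = b * fst p" using Lmax0 by (simp add: algebra_simps)
      then have "(b - vmax) * W p > 0" using \<open>b * fst p > 0\<close> by simp
      then have bv: "b - vmax > 0" using Wp by (simp add: zero_less_mult_iff)
      show False
      proof (rule ctrl_prop_no_drift[OF D, of "{q \<in> Gset. ?Lmax q \<le> 0}" 1])
        show "p \<in> {q \<in> Gset. ?Lmax q \<le> 0}" using p Lmax0 by simp
        show "flow t q u \<in> {q \<in> Gset. ?Lmax q \<le> 0}"
          if "q \<in> {q \<in> Gset. ?Lmax q \<le> 0}" "u \<in> adm" "0 \<le> t" for q u t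
        proof -
          have "0 \<le> exp (b * t) * (- ?Lmax q)" using that by (intro mult_nonneg_nonneg) auto
          also have "\<dots> \<le> - ?Lmax (flow t q u)" using that by (intro grow_max) auto
          finally show ?thesis using that flow_in_Gset[of q u t] by auto
        qed
        show "1 * b * (W q - fst q) > 0" if q: "q \<in> {q \<in> Gset. ?Lmax q \<le> 0}" for q
        proof -
          have "b * fst q > 0" using 3 q by (simp add: Gset_def)
          then have "(b - vmax) * W q > 0" using q by (simp add: algebra_simps)
          then have "W q > 0" using bv by (simp add: zero_less_mult_iff)
          then have "vmax * W q > 0" using vmax_pos by simp
          then show ?thesis using q by auto
        qed
      qed
    qed
    ultimately show ?thesis using 3 p Lmin Lmax by (simp add: sector_def)
  qed
qed

section \<open>Approximate controllability inside the sector\<close>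

definition point :: "real \<Rightarrow> real \<Rightarrow> real \<times> real" where
  "point x z = (x, z + \<beta> / \<alpha> * (x - 1))"

lemma point_simps [simp]: "fst (point x z) = x" "Z (point x z) = z" "point (fst p) (Z p) = p"
  by (auto simp: point_def Z_def prod_eq_iff)

lemma tendsto_point:
  "(f \<longlongrightarrow> x) F \<Longrightarrow> (g \<longlongrightarrow> z) F \<Longrightarrow> ((\<lambda>t. point (f t) (g t)) \<longlongrightarrow> point x z) F"
  unfolding point_def by (intro tendsto_intros)

text \<open>Comparing the two bounds gives \<open>(vmax - vmin) * W p \<ge> 0\<close>. At
  \<open>W p = 0\<close> they contradict \<open>fst p > 0\<close> unless \<open>b = 0\<close>, but
  then \<open>W p = 1\<close>.\<close>

lemma sector_W_pos:
  assumes "p \<in> sector"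
  shows "W p > 0"
proof -
  have "fst p > 0" using assms by (simp add: sector_def Gset_def)
  have "(vmax - vmin) * W p \<ge> 0"
    using assms by (simp add: sector_def algebra_simps split: if_splits)
  then have "W p \<ge> 0" using vmin_neg vmax_pos by (simp add: zero_le_mult_iff)
  moreover have "W p \<noteq> 0"
  proof
    assume "W p = 0"
    then have "b \<noteq> 0" by (auto simp: W_def)
    with assms \<open>W p = 0\<close> \<open>fst p > 0\<close> show False
      by (auto simp: sector_def mult_less_0_iff mult_le_0_iff zero_le_mult_iff split: if_splits)
  qed
  ultimately show ?thesis by simp
qed

text \<open>The constant speed keeping the ratio \<open>W / x\<close> fixed.\<close>

definition ray_speed :: "real \<times> real \<Rightarrow> real" where
  "ray_speed p = b * (W p - fst p) / W p"

lemma ray_speed_W: "p \<in> sector \<Longrightarrow> ray_speed p * W p = b * (W p - fst p)"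
  using sector_W_pos[of p] by (simp add: ray_speed_def)

lemma ray_speed_bounds:
  assumes "p \<in> sector"
  shows "vmin \<le> ray_speed p" "ray_speed p \<le> vmax"
    "b \<ge> 0 \<Longrightarrow> vmin < ray_speed p" "b \<ge> 0 \<Longrightarrow> ray_speed p < vmax"
  using assms sector_W_pos[OF assms]
  by (auto simp: ray_speed_def sector_def field_simps split: if_splits)

lemma ray_speed_diff: "p \<in> sector \<Longrightarrow> b - ray_speed p = b * fst p / W p"
  using sector_W_pos[of p] by (simp add: ray_speed_def field_simps)

text \<open>For \<open>b \<noteq> 0\<close> and the ray speed \<open>v\<close>, the functional
  \<open>(b - v) * W - b * x\<close> vanishes at \<open>p\<close> and stays zero. So
  \<open>W\<close> and \<open>x\<close> scale by one factor, under which the sector inequalities are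
  homogeneous.\<close>

lemma ray_flow_in_sector:
  assumes p: "p \<in> sector" and t: "0 \<le> t"
  shows "speed_flow t p (ray_speed p) \<in> sector"
proof -
  let ?v = "ray_speed p" and ?q = "speed_flow t p (ray_speed p)"
  note v = ray_speed_bounds(1,2)[OF p]
  have pG: "p \<in> Gset" using p by (simp add: sector_def)
  have qG: "?q \<in> Gset" by (rule flow_in_Gset[OF pG speed_admissible[OF v] t])
  show ?thesis
  proof (cases "b = 0")
    case True
    then show ?thesis using qG sector_eq_Gset by blast
  next
    case False
    have fp: "fst p > 0" using pG by (simp add: Gset_def)
    have x: "fst ?q = fst p * exp (?v * t)" by (rule speed_flow_fst[OF v t])
    have "- b * fst ?q + (b - ?v) * W ?q = exp (b * t) * (- b * fst p + (b - ?v) * W p)"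
      by (rule W_growth_speed[OF pG v t]) simp
    also have "- b * fst p + (b - ?v) * W p = 0"
      using ray_speed_W[OF p] by (simp add: algebra_simps)
    finally have "b * fst p / W p * W ?q = b * fst ?q"
      by (simp add: ray_speed_diff[OF p])
    then have w: "W ?q = W p * exp (?v * t)"
      using False fp sector_W_pos[OF p] by (simp add: x field_simps)
    have scale: "b * (W ?q - fst ?q) = b * (W p - fst p) * exp (?v * t)"
      "vmin * W ?q = vmin * W p * exp (?v * t)" "vmax * W ?q = vmax * W p * exp (?v * t)"
      by (simp_all add: x w algebra_simps)
    show ?thesis
      using p qG unfolding sector_def mem_Collect_eq scale
      by (simp split: if_splits)
  qed
qed

lemma zero_speed: "vmin \<le> 0" "0 \<le> vmax"
  using vmin_neg vmax_pos by auto

lemma zero_speed_flow: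
  assumes "p \<in> Gset" "0 \<le> t"
  shows "fst (speed_flow t p 0) = fst p"
    and "b * Z (speed_flow t p 0) + \<kappa> * (fst p - 1) = exp (b * t) * (b * Z p + \<kappa> * (fst p - 1))"
proof -
  show x: "fst (speed_flow t p 0) = fst p"
    using speed_flow_fst[OF zero_speed assms(2), of p] by simp
  have "\<kappa> * fst (speed_flow t p 0) + b * Z (speed_flow t p 0) + - \<kappa> =
      exp (b * t) * (\<kappa> * fst p + b * Z p + - \<kappa>)"
    by (rule Z_growth_speed[OF assms(1) zero_speed assms(2)]) (simp add: algebra_simps)
  then show "b * Z (speed_flow t p 0) + \<kappa> * (fst p - 1) = exp (b * t) * (b * Z p + \<kappa> * (fst p - 1))"
    unfolding x by (simp add: algebra_simps)
qed

lemma Z_lower_bound: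
  assumes p: "p \<in> Gset" and u: "u \<in> adm" and t: "0 \<le> t"
    and ge: "\<And>s. 0 \<le> s \<Longrightarrow> s \<le> t \<Longrightarrow> m \<le> \<sigma> * (b * Z (flow s p u) + \<kappa> * (fst (flow s p u) - 1))"
  shows "\<sigma> * Z p + m * t \<le> \<sigma> * Z (flow t p u)"
proof -
  have "\<sigma> * Z (flow 0 p u) - m * 0 \<le> \<sigma> * Z (flow t p u) - m * t"
  proof (rule flow_mono[OF u t])
    show "continuous_on {0..t} (\<lambda>s. \<sigma> * Z (flow s p u) - m * s)"
      by (intro continuous_intros continuous_on_flow_time u) auto
    fix s assume s: "s \<in> {0<..<t}" and
      D: "((\<lambda>s. fst (flow s p u)) has_real_derivative u s * \<alpha> * fst (flow s p u)) (at s)"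
      "((\<lambda>s. snd (flow s p u)) has_real_derivative
         a * (fst (flow s p u) - 1) + b * snd (flow s p u) + u s * fst (flow s p u) * \<beta>) (at s)"
    have "((\<lambda>s. \<sigma> * Z (flow s p u) - m * s) has_real_derivative
       \<sigma> * (b * Z (flow s p u) + \<kappa> * (fst (flow s p u) - 1)) - m) (at s)"
      unfolding Z_def using alpha_nz
      by (auto intro!: derivative_eq_intros D simp: \<kappa>_def field_simps)
    then show "\<exists>d\<ge>0. ((\<lambda>s. \<sigma> * Z (flow s p u) - m * s) has_real_derivative d) (at s)"
      using ge[of s] s by (intro exI conjI) auto
  qed
  then show ?thesis using u by simp
qed

text \<open>For \<open>b \<ge> 0\<close> an equilibrium is not attracting: a small displacement with \<open>v \<noteq> 0\<close> followed by
  \<open>v = 0\<close> drifts along the vertical line in either direction, arbitrarily close to any point of it.\<close>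

lemma equilibrium_reaches_vertical_line:
  assumes b: "0 \<le> b" and e: "e \<in> equilibria" "e \<in> closure (orbit p)" and q: "fst q = fst e"
  shows "q \<in> closure (orbit p)"
proof (cases "Z q = Z e")
  case True
  then have "q = e" using q by (metis point_simps(3))
  then show ?thesis using e by simp
next
  case False
  \<comment> \<open>The vertical direction from \<open>e\<close> to \<open>q\<close>; the speed
    \<open>v\<close> is then chosen with \<open>\<sigma> * \<kappa> * v > 0\<close>, so that it
    turns \<open>Z'\<close> in this direction.\<close>
  define \<sigma> :: real where "\<sigma> = (if Z q > Z e then 1 else -1)"
  have \<sigma>: "\<sigma> * Z e < \<sigma> * Z q" "\<sigma> * \<sigma> = 1"
    using False by (auto simp: \<sigma>_def)
  define v where "v = (if \<sigma> * \<kappa> > 0 then vmax else vmin)"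
  have v: "vmin \<le> v" "v \<le> vmax"
    using vmin_neg vmax_pos by (auto simp: v_def)
  have "\<sigma> * \<kappa> > 0 \<or> \<sigma> * \<kappa> < 0" using kappa_nz unfolding \<sigma>_def by auto
  then have sv: "\<sigma> * \<kappa> * v > 0"
    using vmin_neg vmax_pos by (auto simp: v_def mult_neg_neg)
  note u = speed_admissible[OF v]
  have eG: "e \<in> Gset" and e0: "b * Z e + \<kappa> * (fst e - 1) = 0" using e by (auto simp: equilibria_def)
  have fe: "fst e > 0" using eG by (simp add: Gset_def)
  let ?H = "\<lambda>p. b * Z p + \<kappa> * (fst p - 1)"
  have Hpos: "\<sigma> * ?H (speed_flow \<tau> e v) > 0" if \<tau>: "\<tau> > 0" for \<tau>
  proof -
    \<comment> \<open>Along the displacement \<open>(exp (- b * s) * ?H)' = \<kappa> * v * fst e *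
      exp ((v - b) * s)\<close>, and \<open>m\<close> is a positive lower bound for \<sigma> times
      this; the absolute value covers both signs of \<open>v - b\<close>.\<close>
    define m where "m = \<sigma> * \<kappa> * v * fst e * exp (- \<bar>v - b\<bar> * \<tau>)"
    let ?g = "\<lambda>s. \<sigma> * exp (- b * s) * ?H (speed_flow s e v) - m * s"
    have "?g 0 \<le> ?g \<tau>"
    proof (rule flow_mono[OF u])
      show "continuous_on {0..\<tau>} ?g"
        by (intro continuous_intros continuous_on_flow_time u) auto
      fix s assume s: "s \<in> {0<..<\<tau>}" and
        D: "((\<lambda>s. fst (speed_flow s e v)) has_real_derivative v / \<alpha> * \<alpha> * fst (speed_flow s e v)) (at s)"
        "((\<lambda>s. snd (speed_flow s e v)) has_real_derivative
           a * (fst (speed_flow s e v) - 1) + b * snd (speed_flow s e v)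
           + v / \<alpha> * fst (speed_flow s e v) * \<beta>) (at s)"
      have dZ: "((\<lambda>s. Z (speed_flow s e v)) has_real_derivative ?H (speed_flow s e v)) (at s)"
        unfolding Z_def using alpha_nz
        by (auto intro!: derivative_eq_intros D simp: \<kappa>_def field_simps)
      have "(?g has_real_derivative
         \<sigma> * \<kappa> * v * (exp (- b * s) * fst (speed_flow s e v)) - m) (at s)"
        using alpha_nz by (auto intro!: derivative_eq_intros D(1) dZ simp: algebra_simps)
      also have "exp (- b * s) * fst (speed_flow s e v) = fst e * exp ((v - b) * s)"
        using speed_flow_fst[OF v, of s e] s by (simp add: algebra_simps flip: exp_add)
      finally have "(?g has_real_derivative
         \<sigma> * \<kappa> * v * fst e * exp ((v - b) * s) - m) (at s)"
        by (simp add: mult.assoc)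
      moreover have "m \<le> \<sigma> * \<kappa> * v * fst e * exp ((v - b) * s)"
      proof -
        have "\<bar>(v - b) * s\<bar> \<le> \<bar>v - b\<bar> * \<tau>"
          unfolding abs_mult using s by (intro mult_left_mono) auto
        then have "- \<bar>v - b\<bar> * \<tau> \<le> (v - b) * s" by linarith
        then show ?thesis
          unfolding m_def using sv fe by (intro mult_left_mono) auto
      qed
      ultimately show "\<exists>d\<ge>0. (?g has_real_derivative d) (at s)"
        by (intro exI conjI) auto
    qed (use \<tau> in auto)
    moreover have "m * \<tau> > 0" using sv fe \<tau> by (simp add: m_def)
    moreover have "?g 0 = 0" using u e0 by simp
    ultimately have "\<sigma> * exp (- b * \<tau>) * ?H (speed_flow \<tau> e v) > 0"
      by linarith
    then have "exp (- b * \<tau>) * (\<sigma> * ?H (speed_flow \<tau> e v)) > 0"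
      by (simp only: mult.assoc mult.left_commute)
    then show ?thesis by (simp add: zero_less_mult_iff)
  qed
  have near: "\<forall>\<^sub>F \<tau> in at_right 0. \<sigma> * Z (speed_flow \<tau> e v) < \<sigma> * Z q"
    and tend: "((\<lambda>\<tau>. fst (speed_flow \<tau> e v)) \<longlongrightarrow> fst e) (at_right 0)"
  proof -
    have "continuous_on {0..} (\<lambda>\<tau>. speed_flow \<tau> e v)"
      by (rule continuous_on_flow_time[OF u]) auto
    then have "((\<lambda>\<tau>. speed_flow \<tau> e v) \<longlongrightarrow> speed_flow 0 e v) (at 0 within {0..})"
      by (simp add: continuous_on_def)
    then have lim: "((\<lambda>\<tau>. speed_flow \<tau> e v) \<longlongrightarrow> e) (at_right 0)"
      using u by (auto intro: tendsto_within_subset)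
    then show "((\<lambda>\<tau>. fst (speed_flow \<tau> e v)) \<longlongrightarrow> fst e) (at_right 0)"
      by (rule tendsto_fst)
    have "((\<lambda>\<tau>. \<sigma> * Z (speed_flow \<tau> e v)) \<longlongrightarrow> \<sigma> * Z e) (at_right 0)"
      unfolding Z_def by (intro tendsto_intros lim)
    then show "\<forall>\<^sub>F \<tau> in at_right 0. \<sigma> * Z (speed_flow \<tau> e v) < \<sigma> * Z q"
      using \<sigma>(1) by (rule order_tendstoD(2))
  qed
  have reach: "point (fst (speed_flow \<tau> e v)) (Z q) \<in> closure (orbit p)"
    if \<tau>: "\<tau> > 0" "\<sigma> * Z (speed_flow \<tau> e v) < \<sigma> * Z q" for \<tau>
  proof -
    let ?r = "speed_flow \<tau> e v"
    have rG: "?r \<in> Gset" using flow_in_Gset[OF eG u] \<tau> by simp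
    have rK: "?r \<in> closure (orbit p)"
      using \<tau> by (intro flow_const_in_closure_orbit speed_control v e) auto
    note u0 = speed_admissible[OF zero_speed]
    \<comment> \<open>As \<open>b \<ge> 0\<close>, at zero speed \<open>\<sigma> * Z'\<close> stays
      at least \<open>\<sigma> * ?H ?r\<close>, so the height of \<open>q\<close> is reached by this
      time; the intermediate value theorem finds the moment.\<close>
    define T where "T = (\<sigma> * Z q - \<sigma> * Z ?r) / (\<sigma> * ?H ?r)"
    have T: "T \<ge> 0" using Hpos[OF \<tau>(1)] \<tau>(2) by (simp add: T_def)
    have "\<sigma> * Z ?r + (\<sigma> * ?H ?r) * T \<le> \<sigma> * Z (speed_flow T ?r 0)"
    proof (rule Z_lower_bound[OF rG u0 T])
      fix s assume s: "0 \<le> s" "s \<le> T"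
      have "1 * (\<sigma> * ?H ?r) \<le> exp (b * s) * (\<sigma> * ?H ?r)"
        using Hpos[OF \<tau>(1)] b s by (intro mult_right_mono) auto
      moreover have "?H (speed_flow s ?r 0) = exp (b * s) * ?H ?r"
        unfolding zero_speed_flow(1)[OF rG s(1)] by (rule zero_speed_flow(2)[OF rG s(1)])
      ultimately show "\<sigma> * ?H ?r \<le> \<sigma> * ?H (speed_flow s ?r 0)"
        by (simp only: mult_1 mult.left_commute)
    qed
    moreover have "(\<sigma> * ?H ?r) * T = \<sigma> * Z q - \<sigma> * Z ?r"
      unfolding T_def times_divide_eq_right
      by (rule nonzero_mult_div_cancel_left) (use Hpos[OF \<tau>(1)] in linarith)
    ultimately have "\<sigma> * Z q \<le> \<sigma> * Z (speed_flow T ?r 0)" by linarith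
    moreover have "\<sigma> * Z (speed_flow 0 ?r 0) \<le> \<sigma> * Z q"
      using \<tau>(2) flow_0[OF u0, of ?r] by simp
    moreover have "continuous_on {0..T} (\<lambda>s. \<sigma> * Z (speed_flow s ?r 0))"
      by (intro continuous_intros continuous_on_flow_time u0) auto
    ultimately obtain s where s: "0 \<le> s" "\<sigma> * Z (speed_flow s ?r 0) = \<sigma> * Z q"
      using IVT'[of "\<lambda>s. \<sigma> * Z (speed_flow s ?r 0)" 0 "\<sigma> * Z q" T] T by auto
    have "\<sigma> \<noteq> 0" using \<sigma>(2) by auto
    then have "Z (speed_flow s ?r 0) = Z q" using s(2) by simp
    then have "speed_flow s ?r 0 = point (fst ?r) (Z q)"
      using zero_speed_flow(1)[OF rG s(1)] by (metis point_simps(3))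
    then show ?thesis
      using flow_const_in_closure_orbit[OF speed_control[OF zero_speed] s(1) rK] by simp
  qed
  \<comment> \<open>Shrinking the initial displacement removes the horizontal error.\<close>
  have "((\<lambda>\<tau>. point (fst (speed_flow \<tau> e v)) (Z q)) \<longlongrightarrow> point (fst e) (Z q)) (at_right 0)"
    by (intro tendsto_point tend tendsto_const)
  moreover have "\<forall>\<^sub>F \<tau> in at_right 0. point (fst (speed_flow \<tau> e v)) (Z q) \<in> closure (orbit p)"
    using near eventually_at_right_less[of "0::real"] by eventually_elim (rule reach)
  ultimately have "point (fst e) (Z q) \<in> closure (orbit p)"
    by (intro Lim_in_closed_set[OF closed_closure]) auto
  then show ?thesis by (metis point_simps(3) q)
qed

text \<open>For \<open>b > 0\<close> a speed slightly beyond the one preserving the ratio \<open>W / x\<close> moves the ratio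
  towards \<open>1\<close> and reaches it in finite time.\<close>

lemma sector_reaches_equilibrium:
  assumes b: "0 \<le> b" and p: "p \<in> sector"
  obtains e where "e \<in> equilibria" "e \<in> closure (orbit p)"
proof -
  have pG: "p \<in> Gset" and fp: "fst p > 0" using p by (auto simp: sector_def Gset_def)
  consider "b = 0" | "p \<in> equilibria" | "b > 0" "p \<notin> equilibria" using b by linarith
  then show ?thesis
  proof cases
    case 1
    \<comment> \<open>For \<open>b = 0\<close> the equilibria are the points with abscissa
      1.\<close>
    obtain q where q: "q \<in> closure (orbit p)" "fst q = 1"
      using reach_abscissa[OF pG, of 1] by auto
    then have "q \<in> equilibria" unfolding equilibria_def Gset_def using 1 by simp
    with q show ?thesis using that by blast
  next
    case 2
    then show ?thesis using that self_in_closure_orbit by blast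
  next
    case 3
    let ?w = "ray_speed p"
    have Wp: "W p > 0" by (rule sector_W_pos[OF p])
    have ne: "W p \<noteq> fst p" using 3 equilibria_iff_W[of p] pG by auto
    have w0: "?w \<noteq> 0" using ne Wp 3 by (simp add: ray_speed_def)
    have bw: "b - ?w > 0" using ray_speed_diff[OF p] 3 fp Wp by simp
    \<comment> \<open>Strict inequalities survive a small \<open>\<epsilon> > 0\<close>: the speed
      \<open>(1 + \<epsilon>) * ?w\<close> stays admissible and below \<open>b\<close>. The second
      limit will give \<open>\<rho> > 1\<close>.\<close>
    have lim: "((\<lambda>\<epsilon>. (1 + \<epsilon>) * ?w) \<longlongrightarrow> (1 + 0) * ?w) (at_right 0)"
      "((\<lambda>\<epsilon>. (1 + \<epsilon>) * fst p - \<epsilon> * W p) \<longlongrightarrow> (1 + 0) * fst p - 0 * W p) (at_right 0)"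
      by (intro tendsto_intros)+
    have "\<forall>\<^sub>F \<epsilon> in at_right 0. vmin < (1 + \<epsilon>) * ?w"
      using order_tendstoD(1)[OF lim(1)] ray_speed_bounds(3)[OF p b] by simp
    moreover have "\<forall>\<^sub>F \<epsilon> in at_right 0. (1 + \<epsilon>) * ?w < vmax"
      using order_tendstoD(2)[OF lim(1)] ray_speed_bounds(4)[OF p b] by simp
    moreover have "\<forall>\<^sub>F \<epsilon> in at_right 0. (1 + \<epsilon>) * ?w < b"
      using order_tendstoD(2)[OF lim(1)] bw by simp
    moreover have "\<forall>\<^sub>F \<epsilon> in at_right 0. 0 < (1 + \<epsilon>) * fst p - \<epsilon> * W p"
      using order_tendstoD(1)[OF lim(2), of 0] fp by simp
    ultimately have "\<forall>\<^sub>F \<epsilon> in at_right 0. 0 < \<epsilon> \<and> vmin < (1 + \<epsilon>) * ?w \<and> (1 + \<epsilon>) * ?w < vmax \<and>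
        (1 + \<epsilon>) * ?w < b \<and> 0 < (1 + \<epsilon>) * fst p - \<epsilon> * W p"
      using eventually_at_right_less[of "0::real"] by eventually_elim blast
    then obtain \<epsilon> :: real where \<epsilon>: "0 < \<epsilon>" "vmin < (1 + \<epsilon>) * ?w" "(1 + \<epsilon>) * ?w < vmax"
        "(1 + \<epsilon>) * ?w < b" "\<epsilon> * W p < (1 + \<epsilon>) * fst p"
      using eventually_happens[of _ "at_right (0::real)"] by auto
    define v where "v = (1 + \<epsilon>) * ?w"
    have v: "vmin \<le> v" "v \<le> vmax" "v < b" using \<epsilon> by (auto simp: v_def)
    \<comment> \<open>Setting \<open>W = x\<close> in the evolution of
      \<open>(b - v) * W - b * x\<close> gives \<open>exp ((b - v) * t) = \<rho>\<close>, which
      determines the time.\<close>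
    define \<rho> where "\<rho> = (1 + \<epsilon>) * fst p / (\<epsilon> * W p)"
    have \<rho>: "\<rho> > 1" using \<epsilon> Wp by (simp add: \<rho>_def)
    define t where "t = ln \<rho> / (b - v)"
    have t: "0 \<le> t" using \<rho> v by (simp add: t_def)
    have "exp ((b - v) * t) = \<rho>" using \<rho> v by (simp add: t_def)
    then have et: "exp (b * t) = \<rho> * exp (v * t)"
      by (simp add: left_diff_distrib exp_diff divide_eq_eq)
    let ?q = "speed_flow t p v"
    have x: "fst ?q = fst p * exp (v * t)" by (rule speed_flow_fst[OF v(1,2) t])
    have "- b * fst ?q + (b - v) * W ?q = exp (b * t) * (- b * fst p + (b - v) * W p)"
      by (rule W_growth_speed[OF pG v(1,2) t]) simp
    also have "- b * fst p + (b - v) * W p = - \<epsilon> * ?w * W p"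
      using ray_speed_W[OF p] by (simp add: v_def algebra_simps)
    also have "exp (b * t) * (- \<epsilon> * ?w * W p) = - v * (fst p * exp (v * t))"
      using \<epsilon> Wp by (simp add: et \<rho>_def v_def field_simps)
    finally have "(b - v) * W ?q = (b - v) * fst ?q"
      by (simp add: x algebra_simps)
    then have "W ?q = fst ?q" using v by simp
    then have "?q \<in> equilibria"
      using equilibria_iff_W 3 flow_in_Gset[OF pG speed_admissible[OF v(1,2)] t] by simp
    then show ?thesis
      using that flow_const_in_closure_orbit[OF speed_control[OF v(1,2)] t self_in_closure_orbit]
      by blast
  qed
qed

text \<open>For \<open>b < 0\<close> zero speed freezes the abscissa and contracts each vertical
  line to its single equilibrium: steer to the line of \<open>e\<close> and wait.\<close>

lemma reaches_equilibrium_attracting: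
  assumes b: "b < 0" and p: "p \<in> Gset" and e: "e \<in> equilibria"
  shows "e \<in> closure (orbit p)"
proof -
  have fe: "fst e > 0" and e0: "b * Z e + \<kappa> * (fst e - 1) = 0"
    using e by (auto simp: equilibria_def Gset_def)
  obtain q where q: "q \<in> closure (orbit p)" "fst q = fst e"
    using reach_abscissa[OF p fe] by blast
  have qG: "q \<in> Gset" using q fe by (simp add: Gset_def)
  let ?H = "b * Z q + \<kappa> * (fst q - 1)"
  have "speed_flow t q 0 = point (fst e) ((exp (b * t) * ?H - \<kappa> * (fst e - 1)) / b)" if "t \<ge> 0" for t
  proof -
    have "Z (speed_flow t q 0) = (exp (b * t) * ?H - \<kappa> * (fst e - 1)) / b"
      using zero_speed_flow(2)[OF qG that] q(2) b by (simp add: field_simps)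
    then show ?thesis using zero_speed_flow(1)[OF qG that] q(2) by (metis point_simps(3))
  qed
  then have mem: "point (fst e) ((exp (b * t) * ?H - \<kappa> * (fst e - 1)) / b) \<in> closure (orbit p)" if "t \<ge> 0" for t
    using flow_const_in_closure_orbit[OF speed_control[OF zero_speed] that q(1)] that by simp
  have "((\<lambda>t. exp (b * t)) \<longlongrightarrow> 0) at_top"
    using b by (intro filterlim_compose[OF exp_at_bot] filterlim_tendsto_neg_mult_at_bot[OF tendsto_const] filterlim_ident)
  then have "((\<lambda>t. point (fst e) ((exp (b * t) * ?H - \<kappa> * (fst e - 1)) / b)) \<longlongrightarrow>
      point (fst e) ((0 * ?H - \<kappa> * (fst e - 1)) / b)) at_top"
    using b by (intro tendsto_point tendsto_intros) auto
  moreover have "(0 * ?H - \<kappa> * (fst e - 1)) / b = Z e"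
    using e0 b by (simp add: field_simps)
  ultimately have "((\<lambda>t. point (fst e) ((exp (b * t) * ?H - \<kappa> * (fst e - 1)) / b)) \<longlongrightarrow> e) at_top"
    by simp
  moreover have "\<forall>\<^sub>F t in at_top. point (fst e) ((exp (b * t) * ?H - \<kappa> * (fst e - 1)) / b) \<in> closure (orbit p)"
    using eventually_ge_at_top[of 0] by eventually_elim (rule mem)
  ultimately show ?thesis
    by (intro Lim_in_closed_set[OF closed_closure]) auto
qed

text \<open>For \<open>b < 0\<close> the ray through \<open>q\<close> attracts under its own speed, so \<open>q\<close> is the limit of end points
  of trajectories started at equilibria with the right abscissa.\<close>

lemma sector_reachable_attracting:
  assumes b: "b < 0" and p: "p \<in> Gset" and q: "q \<in> sector"
  shows "q \<in> closure (orbit p)"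
proof -
  let ?v = "ray_speed q"
  note v = ray_speed_bounds(1,2)[OF q]
  have qG: "q \<in> Gset" and fq: "fst q > 0" using q by (auto simp: sector_def Gset_def)
  have Wq: "W q > 0" by (rule sector_W_pos[OF q])
  have bv: "b - ?v < 0" using ray_speed_diff[OF q] b fq Wq by (simp add: mult_neg_pos divide_neg_pos)
  \<comment> \<open>The value of \<open>Z\<close> after time \<open>t\<close> at the ray speed, when
    the start is the equilibrium whose abscissa moves to \<open>fst q\<close> in that time.\<close>
  define z where "z t = (1 - (b * fst q - ?v * fst q * exp ((b - ?v) * t)) / (b - ?v)) * \<kappa> / b" for t
  have mem: "point (fst q) (z t) \<in> closure (orbit p)" if t: "t \<ge> 0" for t
  proof -
    define s where "s = fst q * exp (- ?v * t)"
    have s: "s > 0" using fq by (simp add: s_def)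
    define e where "e = point s (- \<kappa> * (s - 1) / b)"
    have e: "e \<in> equilibria" using b s by (simp add: e_def equilibria_def Gset_def)
    then have eG: "e \<in> Gset" and We: "W e = s"
      using equilibria_iff_W[of e] b by (auto simp: e_def)
    have fe: "fst e = s" by (simp add: e_def)
    let ?r = "speed_flow t e ?v"
    have x: "fst ?r = fst q"
      using speed_flow_fst[OF v t, of e] by (simp add: e_def s_def exp_minus)
    have "- b * fst ?r + (b - ?v) * W ?r = exp (b * t) * (- b * fst e + (b - ?v) * W e)"
      by (rule W_growth_speed[OF eG v t]) simp
    also have "\<dots> = - ?v * s * exp (b * t)" by (simp add: We fe algebra_simps)
    also have "\<dots> = - ?v * fst q * exp ((b - ?v) * t)"
      by (simp add: s_def algebra_simps flip: exp_add)
    finally have "W ?r = (b * fst q - ?v * fst q * exp ((b - ?v) * t)) / (b - ?v)"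
      using bv by (simp add: x field_simps)
    then have "Z ?r = z t"
      using b kappa_nz unfolding z_def by (simp add: W_def field_simps)
    then have "?r = point (fst q) (z t)" using x by (metis point_simps(3))
    then show ?thesis
      using flow_const_in_closure_orbit[OF speed_control[OF v] t reaches_equilibrium_attracting[OF b p e]]
      by simp
  qed
  \<comment> \<open>The decaying term leaves \<open>W = b * fst q / (b - ?v)\<close>, which is
    \<open>W q\<close> by the choice of the ray speed.\<close>
  have "((\<lambda>t. exp ((b - ?v) * t)) \<longlongrightarrow> 0) at_top"
    using bv by (intro filterlim_compose[OF exp_at_bot] filterlim_tendsto_neg_mult_at_bot[OF tendsto_const] filterlim_ident)
  then have "(z \<longlongrightarrow> (1 - (b * fst q - ?v * fst q * 0) / (b - ?v)) * \<kappa> / b) at_top"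
    unfolding z_def[abs_def] using b bv by (intro tendsto_intros) auto
  moreover have "(b * fst q - ?v * fst q * 0) / (b - ?v) = W q"
    using ray_speed_diff[OF q] b fq Wq by simp
  moreover have "(1 - W q) * \<kappa> / b = Z q"
    using b kappa_nz by (simp add: W_def)
  ultimately have "(z \<longlongrightarrow> Z q) at_top" by simp
  then have "((\<lambda>t. point (fst q) (z t)) \<longlongrightarrow> point (fst q) (Z q)) at_top"
    by (intro tendsto_point tendsto_const)
  then have "((\<lambda>t. point (fst q) (z t)) \<longlongrightarrow> q) at_top" by simp
  moreover have "\<forall>\<^sub>F t in at_top. point (fst q) (z t) \<in> closure (orbit p)"
    using eventually_ge_at_top[of 0] by eventually_elim (rule mem)
  ultimately show ?thesis
    by (intro Lim_in_closed_set[OF closed_closure]) auto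
qed

text \<open>The ray speed keeps points inside. For \<open>b \<ge> 0\<close>, reachability leads to
  an equilibrium, then to its whole vertical line, then to any point; for \<open>b < 0\<close> it
  uses equilibria chosen for the target.\<close>

lemma ctrl_prop_sector: "ctrl_prop a b \<alpha> \<beta> ulo uhi sector"
  unfolding ctrl_prop_def
proof (intro conjI ballI subsetI)
  show "p \<in> Gset" if "p \<in> sector" for p using that by (simp add: sector_def)
  fix p assume p: "p \<in> sector"
  show "\<exists>u\<in>adm. \<forall>t\<ge>0. flow t p u \<in> sector"
    using ray_flow_in_sector[OF p] speed_admissible[OF ray_speed_bounds(1,2)[OF p]] by blast
  fix q assume q: "q \<in> sector"
  have G: "p \<in> Gset" "q \<in> Gset" using p q by (auto simp: sector_def)
  have "q \<in> closure (orbit p)"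
  proof (cases "b < 0")
    case True
    then show ?thesis using sector_reachable_attracting G q by blast
  next
    case False
    then have b: "0 \<le> b" by simp
    obtain e where e: "e \<in> equilibria" "e \<in> closure (orbit p)"
      using sector_reaches_equilibrium[OF b p] by blast
    then show ?thesis
      using reach_from_abscissa[of "fst e" p q] equilibrium_reaches_vertical_line[OF b e] G(2)
      by (auto simp: equilibria_def Gset_def)
  qed
  then show "q \<in> closure (orbit p) \<inter> Gset" using G by simp
qed

lemma control_set_sector: "control_set a b \<alpha> \<beta> ulo uhi C \<longleftrightarrow> C = sector"
  by (rule control_set_unique[OF ctrl_prop_sector ctrl_prop_in_sector])

lemma interior_sector: "interior sector \<noteq> {}"
proof -
  let ?O = "{p. 0 < fst p} \<inter> {p. vmin * W p < b * (W p - fst p)} \<inter> {p. b * (W p - fst p) < vmax * W p}"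
  have "open ?O"
    by (intro open_Int open_Collect_less continuous_intros)
  moreover have "?O \<subseteq> sector" by (auto simp: sector_def Gset_def)
  \<comment> \<open>At the group identity \<open>W = fst = 1\<close>, and the inequalities read
    \<open>vmin < 0 < vmax\<close>.\<close>
  moreover have "(1, 0) \<in> ?O" using vmin_neg vmax_pos by (simp add: W_def Z_def)
  ultimately show ?thesis using interior_maximal[of ?O sector] by blast
qed

end

section \<open>The Lie algebra rank condition\<close>

lemma frechet_derivative_fld:
  "frechet_derivative (fld a b \<alpha> \<beta> u) (at p) =
     (\<lambda>h. (u * \<alpha> * fst h, a * fst h + b * snd h + u * fst h * \<beta>))"
proof (rule frechet_derivative_at[symmetric])
  have "((\<lambda>p. (u * \<alpha> * fst p, a * (fst p - 1) + b * snd p + u * fst p * \<beta>)) has_derivative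
     (\<lambda>h. (u * \<alpha> * fst h, a * fst h + b * snd h + u * fst h * \<beta>))) (at p)"
    by (auto intro!: derivative_eq_intros)
  then show "(fld a b \<alpha> \<beta> u has_derivative
     (\<lambda>h. (u * \<alpha> * fst h, a * fst h + b * snd h + u * fst h * \<beta>))) (at p)"
    by (simp add: fld_def[abs_def])
qed

context nonvertical_system
begin

text \<open>If \<open>\<kappa> = 0\<close>, all fields of the system lie in the span of two commuting fields: the
  right-invariant field \<open>(\<alpha> x, \<beta> x)\<close> and the field \<open>(0, Z)\<close>, which vanishes on \<open>Z = 0\<close>.\<close>

definition commuting_field :: "real \<Rightarrow> real \<Rightarrow> real \<times> real \<Rightarrow> real \<times> real" where
  "commuting_field l m p = (l * \<alpha> * fst p, l * \<beta> * fst p + m * Z p)"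

lemma frechet_derivative_commuting_field:
  "frechet_derivative (commuting_field l m) (at p) =
     (\<lambda>h. (l * \<alpha> * fst h, l * \<beta> * fst h + m * (snd h - \<beta> / \<alpha> * fst h)))"
proof (rule frechet_derivative_at[symmetric])
  show "(commuting_field l m has_derivative
     (\<lambda>h. (l * \<alpha> * fst h, l * \<beta> * fst h + m * (snd h - \<beta> / \<alpha> * fst h)))) (at p)"
    unfolding commuting_field_def[abs_def] Z_def
    using alpha_nz by (auto intro!: derivative_eq_intros)
qed

text \<open>The family \<open>commuting_field l m\<close> is closed under linear combinations and
  all its brackets vanish, so the generated algebra never leaves it.\<close>

lemma lie_gen_kappa_zero:
  assumes "\<kappa> = 0" "X \<in> lie_gen a b \<alpha> \<beta> ulo uhi"
  shows "\<exists>l m. X = commuting_field l m"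
  using assms(2)
proof induction
  case (gen u)
  have a: "a = - (b * \<beta> / \<alpha>)" using assms(1) alpha_nz by (simp add: \<kappa>_def field_simps)
  have "fld a b \<alpha> \<beta> u = commuting_field u b"
    using alpha_nz by (simp add: fld_def commuting_field_def Z_def a fun_eq_iff field_simps)
  then show ?case by blast
next
  case (add X Y)
  then obtain l m l' m' where "X = commuting_field l m" "Y = commuting_field l' m'" by blast
  then have "(\<lambda>p. X p + Y p) = commuting_field (l + l') (m + m')"
    by (simp add: commuting_field_def fun_eq_iff algebra_simps)
  then show ?case by blast
next
  case (scale X c)
  then obtain l m where "X = commuting_field l m" by blast
  then have "(\<lambda>p. c *\<^sub>R X p) = commuting_field (c * l) (c * m)"
    by (simp add: commuting_field_def fun_eq_iff algebra_simps)
  then show ?case by blast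
next
  case (bracket X Y)
  then obtain l m l' m' where XY: "X = commuting_field l m" "Y = commuting_field l' m'" by blast
  have "lie_bracket X Y p = commuting_field 0 0 p" for p
    unfolding XY lie_bracket_def frechet_derivative_commuting_field
    using alpha_nz by (simp add: commuting_field_def zero_prod_def field_simps)
  then have "lie_bracket X Y = commuting_field 0 0" by (rule ext)
  then show ?case by blast
qed

text \<open>If \<open>\<kappa> = 0\<close>, all generated fields are multiples of
  \<open>(\<alpha>, \<beta>)\<close> at \<open>(1, 0)\<close>, where \<open>Z\<close> vanishes.
  Otherwise the bracket of the fields for \<open>0\<close> and \<open>uhi\<close> is vertical and
  nonzero, and the field for \<open>uhi\<close> is not vertical.\<close>

lemma LARC_iff_kappa: "LARC a b \<alpha> \<beta> ulo uhi \<longleftrightarrow> \<kappa> \<noteq> 0"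
proof
  assume LARC: "LARC a b \<alpha> \<beta> ulo uhi"
  show "\<kappa> \<noteq> 0"
  proof
    assume "\<kappa> = 0"
    let ?V = "{q. \<beta> * fst q = \<alpha> * snd q}"
    have "{X (1, 0) | X. X \<in> lie_gen a b \<alpha> \<beta> ulo uhi} \<subseteq> ?V"
      using lie_gen_kappa_zero[OF \<open>\<kappa> = 0\<close>] by (fastforce simp: commuting_field_def Z_def)
    moreover have "subspace ?V"
      by (auto simp: subspace_def algebra_simps)
    ultimately have "span {X (1, 0) | X. X \<in> lie_gen a b \<alpha> \<beta> ulo uhi} \<subseteq> ?V"
      by (rule span_minimal)
    moreover have "(0, 1) \<notin> ?V" using alpha_nz by simp
    moreover have "(1, 0) \<in> Gset" by (simp add: Gset_def)
    ultimately show False using LARC unfolding LARC_def by blast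
  qed
next
  assume k: "\<kappa> \<noteq> 0"
  show "LARC a b \<alpha> \<beta> ulo uhi"
    unfolding LARC_def
  proof
    fix p assume "p \<in> Gset"
    then have x: "fst p > 0" by (simp add: Gset_def)
    let ?S = "{X p | X. X \<in> lie_gen a b \<alpha> \<beta> ulo uhi}"
    let ?X = "fld a b \<alpha> \<beta> uhi" and ?B = "lie_bracket (fld a b \<alpha> \<beta> 0) (fld a b \<alpha> \<beta> uhi)"
    have gen: "?X \<in> lie_gen a b \<alpha> \<beta> ulo uhi" "?B \<in> lie_gen a b \<alpha> \<beta> ulo uhi"
      using ulo_neg uhi_pos by (auto intro!: lie_gen.intros)
    have B: "?B p = (0, - (uhi * fst p * \<alpha> * \<kappa>))"
      using alpha_nz
      by (simp add: lie_bracket_def frechet_derivative_fld) (simp add: fld_def \<kappa>_def field_simps)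
    have "q \<in> span ?S" for q
    proof -
      \<comment> \<open>A triangular system: \<open>c\<close> matches the first coordinate, then
        \<open>d\<close> corrects the second.\<close>
      define c where "c = fst q / (uhi * \<alpha> * fst p)"
      define d where "d = (snd q - c * snd (?X p)) / (- (uhi * fst p * \<alpha> * \<kappa>))"
      have "fst (c *\<^sub>R ?X p + d *\<^sub>R ?B p) = fst q"
        using x alpha_nz uhi_pos by (simp add: B c_def fld_def)
      moreover have "snd (c *\<^sub>R ?X p + d *\<^sub>R ?B p) = snd q"
        using x alpha_nz uhi_pos k by (simp add: B d_def)
      ultimately have "q = c *\<^sub>R ?X p + d *\<^sub>R ?B p"
        by (simp add: prod_eq_iff)
      also have "\<dots> \<in> span ?S"
        using gen by (intro span_add span_scale span_base) blast+
      finally show ?thesis .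
    qed
    then show "span ?S = UNIV" by blast
  qed
qed

lemma interior_degenerate: "interior {p \<in> Gset. Z p = 0} = {}"
proof (rule ccontr)
  assume "interior {p \<in> Gset. Z p = 0} \<noteq> {}"
  then obtain p e where e: "e > 0" "ball p e \<subseteq> {p \<in> Gset. Z p = 0}"
    using mem_interior by blast
  have "p \<in> ball p e" "p + (0, e / 2) \<in> ball p e"
    using e(1) by (auto simp: dist_norm norm_prod_def)
  then have "Z p = 0" "Z (p + (0, e / 2)) = 0" using e(2) by blast+
  then show False using e(1) by (simp add: Z_def)
qed

end

section \<open>Existence of control sets and vertical systems\<close>

context linear_control_system
begin

text \<open>In the union of a chain each point keeps the control from a member containing it, and
  any two points lie in a common member, which gives approximate reachability.\<close>

lemma ctrl_prop_extends_to_control_set: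
  assumes "ctrl_prop a b \<alpha> \<beta> ulo uhi D"
  obtains C where "control_set a b \<alpha> \<beta> ulo uhi C" "D \<subseteq> C"
proof -
  let ?A = "{E. ctrl_prop a b \<alpha> \<beta> ulo uhi E \<and> D \<subseteq> E}"
  have "\<exists>M\<in>?A. \<forall>X\<in>?A. M \<subseteq> X \<longrightarrow> X = M"
  proof (rule subset_Zorn_nonempty)
    show "?A \<noteq> {}" using assms by blast
    fix K assume K: "K \<noteq> {}" "subset.chain ?A K"
    then have ch: "\<And>E F. E \<in> K \<Longrightarrow> F \<in> K \<Longrightarrow> E \<subseteq> F \<or> F \<subseteq> E"
      and props: "\<And>E. E \<in> K \<Longrightarrow> ctrl_prop a b \<alpha> \<beta> ulo uhi E" "\<And>E. E \<in> K \<Longrightarrow> D \<subseteq> E"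
      unfolding subset.chain_def by blast+
    have "ctrl_prop a b \<alpha> \<beta> ulo uhi (\<Union>K)"
      unfolding ctrl_prop_def
    proof (intro conjI ballI subsetI)
      show "p \<in> Gset" if "p \<in> \<Union>K" for p
        using that props(1) unfolding ctrl_prop_def by blast
      fix p assume "p \<in> \<Union>K"
      then obtain E where E: "E \<in> K" "p \<in> E" by blast
      then show "\<exists>u\<in>adm. \<forall>t\<ge>0. flow t p u \<in> \<Union>K"
        using props(1)[of E] unfolding ctrl_prop_def by blast
      fix q assume "q \<in> \<Union>K"
      then obtain F where F: "F \<in> K" "q \<in> F" by blast
      obtain H where "H \<in> K" "p \<in> H" "q \<in> H"
        using ch[OF E(1) F(1)] E F by blast
      then show "q \<in> closure (orbit p) \<inter> Gset"
        using props(1)[of H] unfolding ctrl_prop_def by blast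
    qed
    with K(1) props(2) show "\<Union>K \<in> ?A" by blast
  qed
  then obtain M where M: "M \<in> ?A" and max: "\<forall>X\<in>?A. M \<subseteq> X \<longrightarrow> X = M" ..
  have "X = M" if "ctrl_prop a b \<alpha> \<beta> ulo uhi X" "M \<subseteq> X" for X
  proof -
    have "X \<in> ?A" using M that by auto
    then show ?thesis using max that(2) by blast
  qed
  then have "control_set a b \<alpha> \<beta> ulo uhi M"
    unfolding control_set_def using M by simp
  then show ?thesis using M by (intro that) auto
qed

lemma ctrl_prop_equilibrium:
  assumes p: "p \<in> Gset" and c: "c \<in> {ulo..uhi}" and eq: "fld a b \<alpha> \<beta> c p = 0"
  shows "ctrl_prop a b \<alpha> \<beta> ulo uhi {p}"
proof -
  have "solves p (\<lambda>_. c) (\<lambda>_. p)"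
    unfolding solves_def using eq by (auto intro!: exI[of _ "{}"])
  then have "flow t p (\<lambda>_. c) = p" if "0 \<le> t" for t
    using flow_eq[OF _ admissible_const[OF c] that] by blast
  then show ?thesis
    unfolding ctrl_prop_def using p admissible_const[OF c] self_in_closure_orbit by blast
qed

text \<open>With \<open>\<alpha> = 0\<close> the first coordinate is constant along trajectories,
  and vertical lines are closed. Control sets over different abscissas are therefore
  distinct.\<close>

lemma ctrl_prop_vertical:
  assumes "\<alpha> = 0" and D: "ctrl_prop a b \<alpha> \<beta> ulo uhi D" "p \<in> D" "q \<in> D"
  shows "fst q = fst p"
proof -
  have "fst (flow t p u) = fst p" if u: "u \<in> adm" and t: "0 \<le> t" for u t
  proof -
    have "\<sigma> * fst (flow 0 p u) \<le> \<sigma> * fst (flow t p u)" for \<sigma>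
    proof (rule flow_mono[OF u t])
      show "continuous_on {0..t} (\<lambda>s. \<sigma> * fst (flow s p u))"
        by (intro continuous_intros continuous_on_flow_time u) auto
      fix s assume "((\<lambda>s. fst (flow s p u)) has_real_derivative u s * \<alpha> * fst (flow s p u)) (at s)"
      then have "((\<lambda>s. \<sigma> * fst (flow s p u)) has_real_derivative \<sigma> * (u s * \<alpha> * fst (flow s p u))) (at s)"
        by (rule DERIV_cmult)
      moreover have "\<sigma> * (u s * \<alpha> * fst (flow s p u)) = 0" using assms(1) by simp
      ultimately show "\<exists>d\<ge>0. ((\<lambda>s. \<sigma> * fst (flow s p u)) has_real_derivative d) (at s)"
        by auto
    qed
    from this[of 1] this[of "-1"] show ?thesis using u by simp
  qed
  then have "orbit p \<subseteq> {r. fst r = fst p}"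
    unfolding pos_orbit_def by blast
  moreover have "closed {r::real \<times> real. fst r = fst p}"
    by (intro closed_Collect_eq continuous_intros)
  ultimately have "closure (orbit p) \<subseteq> {r. fst r = fst p}"
    by (rule closure_minimal)
  moreover have "q \<in> closure (orbit p)"
    using D unfolding ctrl_prop_def by blast
  ultimately show ?thesis by blast
qed

lemma infinite_vertical_control_sets:
  assumes "\<alpha> = 0" "\<beta> \<noteq> 0" "(a, b) \<noteq> (0, 0)"
  shows "infinite {C. control_set a b \<alpha> \<beta> ulo uhi C}"
proof -
  let ?E = "{x. 0 < x \<and> (\<exists>u\<in>{ulo..uhi}. \<exists>y. a * (x - 1) + b * y + u * x * \<beta> = 0)}"
  have "infinite ?E"
  proof (cases "b = 0")
    case False
    \<comment> \<open>With \<open>b \<noteq> 0\<close> the zero control has an equilibrium on every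
      vertical line.\<close>
    have "{1<..<2} \<subseteq> ?E"
    proof
      fix x :: real assume "x \<in> {1<..<2}"
      then show "x \<in> ?E"
        using False ulo_neg uhi_pos
        by (auto intro!: bexI[of _ 0] exI[of _ "- a * (x - 1) / b"])
    qed
    moreover have "infinite {1<..<2::real}" by simp
    ultimately show ?thesis using infinite_super by blast
  next
    case True
    \<comment> \<open>With \<open>b = 0\<close> the height drops out; this control value makes the
      whole line stationary and tends to 0 as \<open>x\<close> tends to 1, hence is admissible
      nearby.\<close>
    let ?u = "\<lambda>x. - a * (x - 1) / (x * \<beta>)"
    have "(?u \<longlongrightarrow> - a * (1 - 1) / (1 * \<beta>)) (at_right 1)"
      using assms(2) by (intro tendsto_intros) auto
    then have "\<forall>\<^sub>F x in at_right 1. ulo < ?u x \<and> ?u x < uhi"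
      using ulo_neg uhi_pos by (intro eventually_conj order_tendstoD) auto
    then obtain r :: real where r: "r > 1" "\<And>x. 1 < x \<Longrightarrow> x < r \<Longrightarrow> ulo < ?u x \<and> ?u x < uhi"
      unfolding eventually_at_right_field by auto
    have "{1<..<r} \<subseteq> ?E"
    proof
      fix x :: real assume x: "x \<in> {1<..<r}"
      have "a * (x - 1) + b * 0 + ?u x * x * \<beta> = 0"
        using x assms(2) by simp
      then show "x \<in> ?E"
        using r(2)[of x] x by (auto intro!: bexI[of _ "?u x"])
    qed
    moreover have "infinite {1<..<r}" using r(1) by simp
    ultimately show ?thesis using infinite_super by blast
  qed
  moreover have "\<forall>x\<in>?E. \<exists>C. control_set a b \<alpha> \<beta> ulo uhi C \<and> (\<exists>y. (x, y) \<in> C)"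
  proof
    fix x assume "x \<in> ?E"
    then obtain u y where x: "0 < x" "u \<in> {ulo..uhi}" "a * (x - 1) + b * y + u * x * \<beta> = 0" by blast
    then have "ctrl_prop a b \<alpha> \<beta> ulo uhi {(x, y)}"
      using assms(1) by (intro ctrl_prop_equilibrium[of _ u]) (auto simp: Gset_def fld_def zero_prod_def)
    then obtain C where "control_set a b \<alpha> \<beta> ulo uhi C" "{(x, y)} \<subseteq> C"
      by (rule ctrl_prop_extends_to_control_set)
    then show "\<exists>C. control_set a b \<alpha> \<beta> ulo uhi C \<and> (\<exists>y. (x, y) \<in> C)"
      by blast
  qed
  then obtain F where F: "\<And>x. x \<in> ?E \<Longrightarrow> control_set a b \<alpha> \<beta> ulo uhi (F x) \<and> (\<exists>y. (x, y) \<in> F x)"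
    using bchoice[of ?E "\<lambda>x C. control_set a b \<alpha> \<beta> ulo uhi C \<and> (\<exists>y. (x, y) \<in> C)"] by blast
  have "inj_on F ?E"
  proof (rule inj_onI)
    fix x x' assume x: "x \<in> ?E" "x' \<in> ?E" "F x = F x'"
    obtain y y' where "(x, y) \<in> F x" "(x', y') \<in> F x'" using F[OF x(1)] F[OF x(2)] by blast
    moreover have "ctrl_prop a b \<alpha> \<beta> ulo uhi (F x)"
      using F[OF x(1)] by (simp add: control_set_def)
    ultimately show "x = x'"
      using ctrl_prop_vertical[OF assms(1), of "F x" "(x', y')" "(x, y)"] x(3) by simp
  qed
  ultimately have "infinite (F ` ?E)" using finite_imageD by blast
  moreover have "F ` ?E \<subseteq> {C. control_set a b \<alpha> \<beta> ulo uhi C}" using F by blast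
  ultimately show ?thesis using infinite_super by blast
qed

end

theorem theorem1:
  fixes a b \<alpha> \<beta> ulo uhi :: real
  assumes "(a, b) \<noteq> (0, 0)" and "(\<alpha>, \<beta>) \<noteq> (0, 0)" and "ulo < 0" and "0 < uhi"
  shows "(\<alpha> = 0 \<longrightarrow> infinite {C. control_set a b \<alpha> \<beta> ulo uhi C})
       \<and> (\<alpha> \<noteq> 0 \<longrightarrow>
            (\<exists>!C. control_set a b \<alpha> \<beta> ulo uhi C)
          \<and> (\<forall>C. control_set a b \<alpha> \<beta> ulo uhi C \<longrightarrow>
                 (interior C \<noteq> {} \<longleftrightarrow> LARC a b \<alpha> \<beta> ulo uhi))
          \<and> (LARC a b \<alpha> \<beta> ulo uhi \<longleftrightarrow> \<alpha> * (a * \<alpha> + b * \<beta>) \<noteq> 0))"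
proof (intro conjI impI)
  interpret linear_control_system a b \<alpha> \<beta> ulo uhi
    by unfold_locales (use assms in auto)
  show "infinite {C. control_set a b \<alpha> \<beta> ulo uhi C}" if "\<alpha> = 0"
    using infinite_vertical_control_sets[OF that] assms(1,2) that by blast
  assume alpha: "\<alpha> \<noteq> 0"
  interpret nonvertical_system a b \<alpha> \<beta> ulo uhi
    by unfold_locales (rule alpha)
  have kappa: "\<kappa> \<noteq> 0 \<longleftrightarrow> \<alpha> * (a * \<alpha> + b * \<beta>) \<noteq> 0"
    using alpha by (simp add: \<kappa>_def)
  then show "LARC a b \<alpha> \<beta> ulo uhi \<longleftrightarrow> \<alpha> * (a * \<alpha> + b * \<beta>) \<noteq> 0"
    by (simp add: LARC_iff_kappa)
  obtain C where C: "\<And>D. control_set a b \<alpha> \<beta> ulo uhi D \<longleftrightarrow> D = C"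
    and int: "interior C \<noteq> {} \<longleftrightarrow> \<kappa> \<noteq> 0"
  proof (cases "\<kappa> = 0")
    case True
    \<comment> \<open>Both \<open>\<kappa> = 0\<close> and \<open>b = 0\<close> would force
      \<open>a = 0\<close>, against the hypothesis on \<open>(a, b)\<close>.\<close>
    then have "b \<noteq> 0" using kappa alpha assms(1) by auto
    then show ?thesis
      using that[OF control_set_kappa_zero[OF True]] interior_degenerate True by simp
  next
    case False
    interpret rank_system a b \<alpha> \<beta> ulo uhi
      by unfold_locales (rule False)
    show ?thesis using that[OF control_set_sector] interior_sector False by simp
  qed
  show "\<exists>!C. control_set a b \<alpha> \<beta> ulo uhi C" unfolding C by blast
  show "\<forall>C. control_set a b \<alpha> \<beta> ulo uhi C \<longrightarrow> (interior C \<noteq> {} \<longleftrightarrow> LARC a b \<alpha> \<beta> ulo uhi)"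
    unfolding C LARC_iff_kappa using int by blast
qed

end
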